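(* Let $(M,\eta,\xi,\phi,g)$ be a closed 3-dimensional contact metric structure with $g$ flat, let $h=\frac12 L_\xi\phi$, and let $E$ be a unit vector field with $hE=E$. Let $f$ be a smooth function on $M$ with $df(\xi)=0$ and $df(\phi E)=0$. Define a metric $g^f$ on $M$ by $$g^f(E,E)=1+f+\tfrac12 f^2,\quad g^f(\phi E,\phi E)=1-f+\tfrac12 f^2,\quad g^f(E,\phi E)=\tfrac12 f^2,$$ $$g^f(\xi,E)=0=g^f(\xi,\phi E),\quad g^f(\xi,\xi)=1,$$ and define an endomorphism field $\phi^f$ by $d\eta(X,Y)=2g^f(X,\phi^fY)$ for all tangent vectors $X,Y$. Then $(M,\eta,\xi,\phi^f,g^f)$ is a generalized Jacobi $(\kappa,\mu)$-structure with $$\kappa=\left(f-\tfrac12f^2\right)\left(2-f+\tfrac12f^2\right),\qquad \mu=2\left(f-\tfrac12f^2\right).$$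
   Context: A contact form on a $(2n+1)$-dimensional manifold $M$ ($n\ge 1$) is a 1-form $\eta$ such that $\eta\wedge(d\eta)^n$ is a volume form. A contact metric structure $(M,\eta,\xi,\phi,g)$ consists of a contact form $\eta$, a vector field $\xi$ (the Reeb field, a unit field), an endomorphism field $\phi$ of $TM$ and a Riemannian metric $g$ with $\eta(\xi)=1$, $\phi^2=-\mathrm{Id}+\eta\otimes\xi$, $\phi\xi=0$ and $d\eta(X,Y)=2g(X,\phi Y)$, where $d\eta(X,Y)=X\eta(Y)-Y\eta(X)-\eta([X,Y])$. The curvature tensor is $R(X,Y)Z=\nabla_X\nabla_YZ-\nabla_Y\nabla_XZ-\nabla_{[X,Y]}Z$ with $\nabla$ the Levi-Civita connection of the metric. A contact metric structure $(M,\eta,\xi,J,g)$ is a generalized Jacobi $(\kappa,\mu)$-structure, for smooth functions $\kappa,\mu$ on $M$, if $R(X,\xi)\xi=\kappa(X-\eta(X)\xi)+\mu\,hX$ for all tangent vectors $X$, where $h=\frac12L_\xi J$ ($L$ is the Lie derivative). *)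

theory Defs
  imports "HOL-Analysis.Analysis" "HOL-Library.Function_Algebras"
begin

instantiation "fun" :: (type, real_vector) real_vector
begin

definition scaleR_fun :: "real \<Rightarrow> ('a \<Rightarrow> 'b) \<Rightarrow> 'a \<Rightarrow> 'b" where
  "scaleR_fun c f = (\<lambda>x. c *\<^sub>R f x)"

instance
  by standard (simp_all add: scaleR_fun_def fun_eq_iff scaleR_add_left scaleR_add_right)

end

text \<open>\<open>Ck_on k S f\<close> and \<open>smooth_on S f\<close> are meant for open \<open>S\<close> only.\<close>

fun Ck_on :: "nat \<Rightarrow> 'e::euclidean_space set \<Rightarrow> ('e \<Rightarrow> 'f::real_normed_vector) \<Rightarrow> bool" where
  "Ck_on 0 S f \<longleftrightarrow> continuous_on S f"
| "Ck_on (Suc k) S f \<longleftrightarrow> (\<forall>x\<in>S. f differentiable (at x)) \<and>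
     (\<forall>v. Ck_on k S (\<lambda>x. frechet_derivative f (at x) v))"

definition smooth_on :: "'e::euclidean_space set \<Rightarrow> ('e \<Rightarrow> 'f::real_normed_vector) \<Rightarrow> bool" where
  "smooth_on S f \<longleftrightarrow> (\<forall>k. Ck_on k S f)"

text \<open>A chart is a pair of its domain and its coordinate map; the whole type \<open>'a\<close> is the manifold,
  and the charts take values in a Euclidean space \<open>'e\<close>, so that there is no boundary.\<close>

type_synonym ('a, 'e) chart = "'a set \<times> ('a \<Rightarrow> 'e)"
type_synonym ('a, 'e) atlas = "('a, 'e) chart set"

definition smooth_manifold ::
  "('a::{t2_space,second_countable_topology}, 'e::euclidean_space) atlas \<Rightarrow> bool" where
  "smooth_manifold A \<longleftrightarrow>
     (\<forall>(U, c)\<in>A. open U \<and> open (c ` U) \<and> homeomorphism U (c ` U) c (inv_into U c)) \<and>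
     (\<Union>(U, c)\<in>A. U) = UNIV \<and>
     (\<forall>(U, c)\<in>A. \<forall>(V, d)\<in>A. smooth_on (c ` (U \<inter> V)) (d \<circ> inv_into U c))"

definition closed_manifold ::
  "('a::{t2_space,second_countable_topology}, 'e::euclidean_space) atlas \<Rightarrow> bool" where
  "closed_manifold A \<longleftrightarrow> smooth_manifold A \<and> compact (UNIV :: 'a set)"

definition smooth_fun :: "('a, 'e::euclidean_space) atlas \<Rightarrow> ('a \<Rightarrow> real) \<Rightarrow> bool" where
  "smooth_fun A f \<longleftrightarrow> (\<forall>(U, c)\<in>A. smooth_on (c ` U) (f \<circ> inv_into U c))"

text \<open>Tangent vectors at \<open>p\<close> are the derivations at \<open>p\<close> of the algebra of smooth functions on the
  manifold. The first clause only makes the representing functional unique.\<close>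

type_synonym 'a tvec = "('a \<Rightarrow> real) \<Rightarrow> real"
type_synonym 'a vfield = "'a \<Rightarrow> 'a tvec"

definition tangent_space :: "('a, 'e::euclidean_space) atlas \<Rightarrow> 'a \<Rightarrow> 'a tvec set" where
  "tangent_space A p = {v.
     (\<forall>f. \<not> smooth_fun A f \<longrightarrow> v f = 0) \<and>
     (\<forall>f g. smooth_fun A f \<longrightarrow> smooth_fun A g \<longrightarrow> v (\<lambda>q. f q + g q) = v f + v g) \<and>
     (\<forall>c f. smooth_fun A f \<longrightarrow> v (\<lambda>q. c * f q) = c * v f) \<and>
     (\<forall>f g. smooth_fun A f \<longrightarrow> smooth_fun A g \<longrightarrow>
        v (\<lambda>q. f q * g q) = f p * v g + g p * v f)}"

definition differential :: "('a \<Rightarrow> real) \<Rightarrow> 'a \<Rightarrow> 'a tvec \<Rightarrow> real" where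
  "differential f p v = v f"

definition deriv_along :: "'a vfield \<Rightarrow> ('a \<Rightarrow> real) \<Rightarrow> 'a \<Rightarrow> real" where
  "deriv_along X f = (\<lambda>p. X p f)"

definition vector_fields :: "('a, 'e::euclidean_space) atlas \<Rightarrow> 'a vfield set" where
  "vector_fields A = {X. (\<forall>p. X p \<in> tangent_space A p) \<and>
     (\<forall>f. smooth_fun A f \<longrightarrow> smooth_fun A (deriv_along X f))}"

definition lie_bracket :: "'a vfield \<Rightarrow> 'a vfield \<Rightarrow> 'a vfield" where
  "lie_bracket X Y = (\<lambda>p f. X p (deriv_along Y f) - Y p (deriv_along X f))"

definition fmult :: "('a \<Rightarrow> real) \<Rightarrow> 'a vfield \<Rightarrow> 'a vfield" where
  "fmult f X = (\<lambda>p. f p *\<^sub>R X p)"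

type_synonym 'a form1 = "'a \<Rightarrow> 'a tvec \<Rightarrow> real"
type_synonym 'a endo = "'a \<Rightarrow> 'a tvec \<Rightarrow> 'a tvec"
type_synonym 'a bilin = "'a \<Rightarrow> 'a tvec \<Rightarrow> 'a tvec \<Rightarrow> real"

definition fibre_linear ::
  "('a, 'e::euclidean_space) atlas \<Rightarrow> ('a \<Rightarrow> 'a tvec \<Rightarrow> 'b::real_vector) \<Rightarrow> bool" where
  "fibre_linear A T \<longleftrightarrow>
     (\<forall>p. \<forall>v\<in>tangent_space A p. \<forall>w\<in>tangent_space A p. T p (v + w) = T p v + T p w) \<and>
     (\<forall>p. \<forall>v\<in>tangent_space A p. \<forall>c. T p (c *\<^sub>R v) = c *\<^sub>R T p v)"

definition fibre_endomorphism :: "('a, 'e::euclidean_space) atlas \<Rightarrow> 'a endo \<Rightarrow> bool" where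
  "fibre_endomorphism A \<phi> \<longleftrightarrow> fibre_linear A \<phi> \<and>
     (\<forall>p. \<forall>v\<in>tangent_space A p. \<phi> p v \<in> tangent_space A p)"

definition fibre_symmetric_bilinear :: "('a, 'e::euclidean_space) atlas \<Rightarrow> 'a bilin \<Rightarrow> bool" where
  "fibre_symmetric_bilinear A g \<longleftrightarrow>
     (\<forall>p. \<forall>u\<in>tangent_space A p. \<forall>v\<in>tangent_space A p. \<forall>w\<in>tangent_space A p.
        g p (u + v) w = g p u w + g p v w) \<and>
     (\<forall>p. \<forall>v\<in>tangent_space A p. \<forall>w\<in>tangent_space A p. \<forall>c. g p (c *\<^sub>R v) w = c * g p v w) \<and>
     (\<forall>p. \<forall>v\<in>tangent_space A p. \<forall>w\<in>tangent_space A p. g p v w = g p w v)"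

definition pair_form :: "'a form1 \<Rightarrow> 'a vfield \<Rightarrow> 'a \<Rightarrow> real" where
  "pair_form \<eta> X = (\<lambda>p. \<eta> p (X p))"

definition app_endo :: "'a endo \<Rightarrow> 'a vfield \<Rightarrow> 'a vfield" where
  "app_endo \<phi> X = (\<lambda>p. \<phi> p (X p))"

definition pair_bilin :: "'a bilin \<Rightarrow> 'a vfield \<Rightarrow> 'a vfield \<Rightarrow> 'a \<Rightarrow> real" where
  "pair_bilin g X Y = (\<lambda>p. g p (X p) (Y p))"

definition one_form :: "('a, 'e::euclidean_space) atlas \<Rightarrow> 'a form1 \<Rightarrow> bool" where
  "one_form A \<eta> \<longleftrightarrow> fibre_linear A \<eta> \<and> (\<forall>X\<in>vector_fields A. smooth_fun A (pair_form \<eta> X))"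

definition endomorphism_field :: "('a, 'e::euclidean_space) atlas \<Rightarrow> 'a endo \<Rightarrow> bool" where
  "endomorphism_field A \<phi> \<longleftrightarrow> fibre_endomorphism A \<phi> \<and>
     (\<forall>X\<in>vector_fields A. app_endo \<phi> X \<in> vector_fields A)"

definition riemannian_metric :: "('a, 'e::euclidean_space) atlas \<Rightarrow> 'a bilin \<Rightarrow> bool" where
  "riemannian_metric A g \<longleftrightarrow> fibre_symmetric_bilinear A g \<and>
     (\<forall>X\<in>vector_fields A. \<forall>Y\<in>vector_fields A. smooth_fun A (pair_bilin g X Y)) \<and>
     (\<forall>p. \<forall>v\<in>tangent_space A p. v \<noteq> 0 \<longrightarrow> g p v v > 0)"

definition ext_deriv :: "'a form1 \<Rightarrow> 'a vfield \<Rightarrow> 'a vfield \<Rightarrow> 'a \<Rightarrow> real" where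
  "ext_deriv \<eta> X Y = (\<lambda>p.
     deriv_along X (pair_form \<eta> Y) p - deriv_along Y (pair_form \<eta> X) p
       - pair_form \<eta> (lie_bracket X Y) p)"

definition lie_deriv_endo :: "'a vfield \<Rightarrow> 'a endo \<Rightarrow> 'a vfield \<Rightarrow> 'a vfield" where
  "lie_deriv_endo \<xi> \<phi> X = lie_bracket \<xi> (app_endo \<phi> X) - app_endo \<phi> (lie_bracket \<xi> X)"

text \<open>The last clause of \<open>levi_civita_connection\<close> only fixes the value outside vector fields, so that
  the connection is unique as a function.\<close>

definition affine_connection ::
  "('a, 'e::euclidean_space) atlas \<Rightarrow> ('a vfield \<Rightarrow> 'a vfield \<Rightarrow> 'a vfield) \<Rightarrow> bool" where
  "affine_connection A D \<longleftrightarrow>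
     (\<forall>X\<in>vector_fields A. \<forall>Y\<in>vector_fields A. D X Y \<in> vector_fields A) \<and>
     (\<forall>X\<in>vector_fields A. \<forall>Y\<in>vector_fields A. \<forall>Z\<in>vector_fields A.
        D (X + Y) Z = D X Z + D Y Z \<and> D X (Y + Z) = D X Y + D X Z) \<and>
     (\<forall>X\<in>vector_fields A. \<forall>Y\<in>vector_fields A. \<forall>f. smooth_fun A f \<longrightarrow>
        D (fmult f X) Y = fmult f (D X Y) \<and>
        D X (fmult f Y) = fmult (deriv_along X f) Y + fmult f (D X Y))"

definition levi_civita_connection ::
  "('a, 'e::euclidean_space) atlas \<Rightarrow> 'a bilin \<Rightarrow> ('a vfield \<Rightarrow> 'a vfield \<Rightarrow> 'a vfield) \<Rightarrow> bool" where
  "levi_civita_connection A g D \<longleftrightarrow> affine_connection A D \<and>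
     (\<forall>X\<in>vector_fields A. \<forall>Y\<in>vector_fields A. D X Y - D Y X = lie_bracket X Y) \<and>
     (\<forall>X\<in>vector_fields A. \<forall>Y\<in>vector_fields A. \<forall>Z\<in>vector_fields A. \<forall>p.
        deriv_along X (pair_bilin g Y Z) p = pair_bilin g (D X Y) Z p + pair_bilin g Y (D X Z) p) \<and>
     (\<forall>X Y. X \<notin> vector_fields A \<or> Y \<notin> vector_fields A \<longrightarrow> D X Y = 0)"

definition levi_civita ::
  "('a, 'e::euclidean_space) atlas \<Rightarrow> 'a bilin \<Rightarrow> 'a vfield \<Rightarrow> 'a vfield \<Rightarrow> 'a vfield" where
  "levi_civita A g = (THE D. levi_civita_connection A g D)"

definition curvature ::
  "('a, 'e::euclidean_space) atlas \<Rightarrow> 'a bilin \<Rightarrow> 'a vfield \<Rightarrow> 'a vfield \<Rightarrow> 'a vfield \<Rightarrow> 'a vfield" where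
  "curvature A g X Y Z =
     levi_civita A g X (levi_civita A g Y Z) - levi_civita A g Y (levi_civita A g X Z)
       - levi_civita A g (lie_bracket X Y) Z"

definition flat_metric :: "('a, 'e::euclidean_space) atlas \<Rightarrow> 'a bilin \<Rightarrow> bool" where
  "flat_metric A g \<longleftrightarrow>
     (\<forall>X\<in>vector_fields A. \<forall>Y\<in>vector_fields A. \<forall>Z\<in>vector_fields A. curvature A g X Y Z = 0)"

text \<open>The value of \<open>\<eta> \<and> (d\<eta>) ^ n\<close> on \<open>X 0, \<dots>, X (2 * n)\<close>, where the wedge product of a
  \<open>k\<close>-form and an \<open>l\<close>-form is the signed sum over all permutations divided by \<open>k! l!\<close>.\<close>

definition contact_volume :: "nat \<Rightarrow> 'a form1 \<Rightarrow> (nat \<Rightarrow> 'a vfield) \<Rightarrow> 'a \<Rightarrow> real" where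
  "contact_volume n \<eta> X = (\<lambda>p.
     (\<Sum>\<sigma> | \<sigma> permutes {..2*n}. of_int (sign \<sigma>) * pair_form \<eta> (X (\<sigma> 0)) p *
        (\<Prod>i<n. ext_deriv \<eta> (X (\<sigma> (2*i + 1))) (X (\<sigma> (2*i + 2))) p)) / 2 ^ n)"

definition contact_form :: "('a, 'e::euclidean_space) atlas \<Rightarrow> 'a form1 \<Rightarrow> bool" where
  "contact_form A \<eta> \<longleftrightarrow> one_form A \<eta> \<and>
     (\<exists>n\<ge>1. DIM('e) = 2*n + 1 \<and>
        (\<forall>p. \<exists>X. (\<forall>i. X i \<in> vector_fields A) \<and> contact_volume n \<eta> X p \<noteq> 0))"

definition reeb_field :: "('a, 'e::euclidean_space) atlas \<Rightarrow> 'a form1 \<Rightarrow> 'a vfield \<Rightarrow> bool" where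
  "reeb_field A \<eta> \<xi> \<longleftrightarrow> \<xi> \<in> vector_fields A \<and> (\<forall>p. \<eta> p (\<xi> p) = 1) \<and>
     (\<forall>X\<in>vector_fields A. \<forall>p. ext_deriv \<eta> \<xi> X p = 0)"

definition unit_vector_field ::
  "('a, 'e::euclidean_space) atlas \<Rightarrow> 'a bilin \<Rightarrow> 'a vfield \<Rightarrow> bool" where
  "unit_vector_field A g X \<longleftrightarrow> X \<in> vector_fields A \<and> (\<forall>p. g p (X p) (X p) = 1)"

definition associated_endo ::
  "('a, 'e::euclidean_space) atlas \<Rightarrow> 'a form1 \<Rightarrow> 'a bilin \<Rightarrow> 'a endo \<Rightarrow> bool" where
  "associated_endo A \<eta> g \<phi> \<longleftrightarrow> (\<forall>X\<in>vector_fields A. \<forall>Y\<in>vector_fields A. \<forall>p.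
     ext_deriv \<eta> X Y p = 2 * pair_bilin g X (app_endo \<phi> Y) p)"

definition contact_metric_structure ::
  "('a, 'e::euclidean_space) atlas \<Rightarrow> 'a form1 \<Rightarrow> 'a vfield \<Rightarrow> 'a endo \<Rightarrow> 'a bilin \<Rightarrow> bool" where
  "contact_metric_structure A \<eta> \<xi> \<phi> g \<longleftrightarrow>
     contact_form A \<eta> \<and> reeb_field A \<eta> \<xi> \<and> endomorphism_field A \<phi> \<and> riemannian_metric A g \<and>
     unit_vector_field A g \<xi> \<and>
     (\<forall>p. \<forall>v\<in>tangent_space A p. \<phi> p (\<phi> p v) = - v + \<eta> p v *\<^sub>R \<xi> p) \<and>
     (\<forall>p. \<phi> p (\<xi> p) = 0) \<and>
     associated_endo A \<eta> g \<phi>"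

definition h_operator :: "'a vfield \<Rightarrow> 'a endo \<Rightarrow> 'a vfield \<Rightarrow> 'a vfield" where
  "h_operator \<xi> \<phi> X = (1/2) *\<^sub>R lie_deriv_endo \<xi> \<phi> X"

definition generalized_jacobi ::
  "('a, 'e::euclidean_space) atlas \<Rightarrow> 'a form1 \<Rightarrow> 'a vfield \<Rightarrow> 'a endo \<Rightarrow> 'a bilin \<Rightarrow>
     ('a \<Rightarrow> real) \<Rightarrow> ('a \<Rightarrow> real) \<Rightarrow> bool" where
  "generalized_jacobi A \<eta> \<xi> \<phi> g \<kappa> \<mu> \<longleftrightarrow>
     contact_metric_structure A \<eta> \<xi> \<phi> g \<and> smooth_fun A \<kappa> \<and> smooth_fun A \<mu> \<and>
     (\<forall>X\<in>vector_fields A.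
        curvature A g X \<xi> \<xi> = fmult \<kappa> (X - fmult (pair_form \<eta> X) \<xi>) + fmult \<mu> (h_operator \<xi> \<phi> X))"

end

theory Submission
  imports Defs "HOL-Computational_Algebra.Polynomial"
begin

text \<open>The proof computes in the frame \<open>E\<close>, \<open>F = \<phi> E\<close>, \<open>\<xi>\<close>. For the flat metric this frame is
orthonormal and its brackets are those of the Lie algebra of rigid motions of the plane:
\<open>[\<xi>, E] = 2 F\<close>, \<open>[\<xi>, F] = 0\<close>, \<open>[E, F] = 2 \<xi>\<close> (lemma \<open>brackets\<close>). The compatibility of \<open>d\<eta>\<close> with
\<open>g\<close> and \<open>h E = E\<close> leave four unknown bracket coefficients, and \<open>R(E, \<xi>) \<xi> = 0\<close> and
\<open>R(E, F) \<xi> = 0\<close> determine all of them.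

In this frame the deformed metric has the entries \<open>a\<close>, \<open>c\<close>, \<open>b\<close> on \<open>E, F\<close>, with \<open>a b - c^2 = 1\<close>. The
determinant makes the metric positive definite and makes \<open>\<phi>f\<close> an almost complex structure on the
contact planes, so the deformed structure is again contact metric (lemma
\<open>contact_metric_deformed\<close>). In the Koszul formula for \<open>\<nabla>\<^sub>X \<xi>\<close> and in \<open>R(X, \<xi>) \<xi>\<close> the entries
of the deformed metric are only differentiated along \<open>\<xi>\<close>, where they are constant. With
\<open>s = 1 - b = f - f^2/2\<close> one gets \<open>R(F, \<xi>) \<xi> = s^2 F\<close>,
\<open>R(E, \<xi>) \<xi> = (s^2 + 4 b s) E - 4 c s F\<close>, \<open>h F = - b F\<close> and
\<open>h E = b E - 2 c F\<close>, which is the Jacobi condition with \<open>\<kappa> = s (2 - s)\<close> and \<open>\<mu> = 2 s\<close>.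

Two facts of differential geometry have to be supplied first. A frame field spans only if tangent
spaces, defined through derivations of global smooth functions, have at most the dimension of the
manifold; this rests on bump functions and Hadamard's lemma (lemma \<open>tangent_space_eq_span\<close>). And
the Levi-Civita connection of a metric must exist, which follows from the Koszul formula as soon as
the metric represents every linear form on vector fields that is linear over the smooth functions
(lemma \<open>levi_civita_is_connection\<close>); a global frame with a smooth reciprocal frame gives this.\<close>

section \<open>Functions with continuous derivatives up to a given order\<close>

lemma Ck_on_cong:
  assumes "open S" "\<And>x. x \<in> S \<Longrightarrow> f x = g x" "Ck_on k S f"
  shows "Ck_on k S g"
  using assms(2,3)
proof (induction k arbitrary: f g)
  case 0
  then show ?case by (simp cong: continuous_on_cong)
next
  case (Suc k)
  have D: "(g has_derivative frechet_derivative f (at x)) (at x)" if "x \<in> S" for x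
  proof (rule has_derivative_transform_within_open[OF _ \<open>open S\<close> that])
    show "(f has_derivative frechet_derivative f (at x)) (at x)"
      using Suc.prems(2) that by (simp add: frechet_derivative_works)
  qed (rule Suc.prems(1))
  have "Ck_on k S (\<lambda>x. frechet_derivative g (at x) v)" for v
  proof (rule Suc.IH)
    show "Ck_on k S (\<lambda>x. frechet_derivative f (at x) v)" using Suc.prems by simp
  qed (use D frechet_derivative_at in metis)
  then show ?case using D by (auto simp: differentiable_def)
qed

text \<open>The derivative may be given by any formula \<open>f'\<close>, so that inductions on \<open>k\<close> can use the rules of
differentiation instead of \<open>frechet_derivative\<close>.\<close>

lemma Ck_on_SucI:
  assumes "open S" "\<And>x. x \<in> S \<Longrightarrow> (f has_derivative f' x) (at x)"
    and "\<And>v. Ck_on k S (\<lambda>x. f' x v)"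
  shows "Ck_on (Suc k) S f"
proof -
  have "Ck_on k S (\<lambda>x. frechet_derivative f (at x) v)" for v
    by (rule Ck_on_cong[OF assms(1) _ assms(3)[of v]])
      (use assms(2) frechet_derivative_at in metis)
  then show ?thesis using assms(2) by (auto simp: differentiable_def)
qed

lemma Ck_on_Suc_has_derivative:
  "Ck_on (Suc k) S f \<Longrightarrow> x \<in> S \<Longrightarrow> (f has_derivative frechet_derivative f (at x)) (at x)"
  by (simp add: frechet_derivative_works)

lemma Ck_on_Suc_imp: "Ck_on (Suc k) S f \<Longrightarrow> Ck_on k S f"
proof (induction k arbitrary: f)
  case 0
  then show ?case
    by (auto intro!: continuous_at_imp_continuous_on differentiable_imp_continuous_within)
next
  case (Suc k)
  then show ?case by (metis Ck_on.simps(2))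
qed

lemma Ck_on_imp_continuous_on: "Ck_on k S f \<Longrightarrow> continuous_on S f"
  by (induction k) (use Ck_on_Suc_imp in auto)

lemma Ck_on_subset: "Ck_on k S f \<Longrightarrow> T \<subseteq> S \<Longrightarrow> Ck_on k T f"
  by (induction k arbitrary: f) (auto intro: continuous_on_subset)

lemma Ck_on_Un:
  "open S \<Longrightarrow> open T \<Longrightarrow> Ck_on k S f \<Longrightarrow> Ck_on k T f \<Longrightarrow> Ck_on k (S \<union> T) f"
  by (induction k arbitrary: f) (auto intro: continuous_on_open_Un)

lemma Ck_on_const: "Ck_on k S (\<lambda>x. c)"
  by (induction k arbitrary: c) auto

lemma Ck_on_bounded_linear:
  assumes "open S" "bounded_linear L"
  shows "Ck_on k S L"
proof (cases k)
  case 0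
  then show ?thesis using assms by (simp add: linear_continuous_on)
next
  case (Suc m)
  show ?thesis unfolding Suc
    by (rule Ck_on_SucI[OF assms(1), of _ "\<lambda>_. L"])
      (use assms in \<open>auto intro: bounded_linear_imp_has_derivative Ck_on_const\<close>)
qed

lemma Ck_on_bounded_linear_comp:
  assumes "open S" "bounded_linear L" "Ck_on k S f"
  shows "Ck_on k S (\<lambda>x. L (f x))"
  using assms(3)
proof (induction k arbitrary: f)
  case 0
  then show ?case using assms(2) by (auto intro: bounded_linear.continuous_on)
next
  case (Suc k)
  show ?case
    by (rule Ck_on_SucI[OF assms(1), of _ "\<lambda>x v. L (frechet_derivative f (at x) v)"])
      (use Suc Ck_on_Suc_has_derivative[OF Suc.prems] in
        \<open>auto intro: bounded_linear.has_derivative[OF assms(2)]\<close>)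
qed

lemma Ck_on_add:
  assumes "open S" "Ck_on k S f" "Ck_on k S g"
  shows "Ck_on k S (\<lambda>x. f x + g x)"
  using assms(2,3)
proof (induction k arbitrary: f g)
  case 0
  then show ?case by (auto intro: continuous_on_add)
next
  case (Suc k)
  show ?case
    by (rule Ck_on_SucI[OF assms(1), of _ "\<lambda>x v. frechet_derivative f (at x) v + frechet_derivative g (at x) v"])
      (use Suc Ck_on_Suc_has_derivative[OF Suc.prems(1)] Ck_on_Suc_has_derivative[OF Suc.prems(2)] in
        \<open>auto intro: has_derivative_add\<close>)
qed

lemma Ck_on_sum:
  assumes "open S" "\<And>i. i \<in> I \<Longrightarrow> Ck_on k S (f i)"
  shows "Ck_on k S (\<lambda>x. \<Sum>i\<in>I. f i x)"
  using assms(2)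
  by (induction I rule: infinite_finite_induct) (auto intro: Ck_on_const Ck_on_add assms(1))

lemma Ck_on_mult:
  fixes f g :: "'e::euclidean_space \<Rightarrow> real"
  assumes "open S" "Ck_on k S f" "Ck_on k S g"
  shows "Ck_on k S (\<lambda>x. f x * g x)"
  using assms(2,3)
proof (induction k arbitrary: f g)
  case 0
  then show ?case by (auto intro: continuous_on_mult)
next
  case (Suc k)
  show ?case
  proof (rule Ck_on_SucI[OF assms(1)])
    show "((\<lambda>x. f x * g x) has_derivative
       (\<lambda>v. f x * frechet_derivative g (at x) v + frechet_derivative f (at x) v * g x)) (at x)"
      if "x \<in> S" for x
      by (rule has_derivative_mult) (use that Suc.prems in \<open>auto intro: Ck_on_Suc_has_derivative\<close>)
    show "Ck_on k S (\<lambda>x. f x * frechet_derivative g (at x) v + frechet_derivative f (at x) v * g x)" for v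
      using Suc.prems Ck_on_Suc_imp[OF Suc.prems(1)] Ck_on_Suc_imp[OF Suc.prems(2)]
      by (intro Ck_on_add[OF assms(1)] Suc.IH) auto
  qed
qed

text \<open>By the chain rule in coordinates, the derivative of \<open>f \<circ> u\<close> is a sum of products of components of
the derivative of \<open>u\<close> and partial derivatives of \<open>f\<close> composed with \<open>u\<close>; the latter are covered by
the induction hypothesis.\<close>

lemma Ck_on_compose:
  fixes u :: "'d::euclidean_space \<Rightarrow> 'e::euclidean_space" and f :: "'e \<Rightarrow> real"
  assumes "open S" "open T" "u ` S \<subseteq> T" "Ck_on k S u" "Ck_on k T f"
  shows "Ck_on k S (\<lambda>x. f (u x))"
  using assms(4,5)
proof (induction k arbitrary: f)
  case 0
  then show ?case using assms(3) by (auto intro: continuous_on_compose2)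
next
  case (Suc k)
  let ?Du = "\<lambda>x. frechet_derivative u (at x)" and ?Df = "\<lambda>y. frechet_derivative f (at y)"
  have Df: "(f has_derivative ?Df (u x)) (at (u x))" if "x \<in> S" for x
    using Ck_on_Suc_has_derivative[OF Suc.prems(2)] that assms(3) by auto
  have expand: "?Df (u x) w = (\<Sum>b\<in>Basis. (w \<bullet> b) * ?Df (u x) b)" if "x \<in> S" for x w
  proof -
    have "bounded_linear (?Df (u x))" using Df[OF that] by (rule has_derivative_bounded_linear)
    then have "linear (?Df (u x))" by (rule bounded_linear.linear)
    then have "?Df (u x) (\<Sum>b\<in>Basis. (w \<bullet> b) *\<^sub>R b) = (\<Sum>b\<in>Basis. (w \<bullet> b) *\<^sub>R ?Df (u x) b)"
      by (simp add: linear_sum linear_cmul)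
    then show ?thesis by (simp add: euclidean_representation)
  qed
  show ?case
  proof (rule Ck_on_SucI[OF assms(1)])
    show "((\<lambda>x. f (u x)) has_derivative (\<lambda>v. \<Sum>b\<in>Basis. (?Du x v \<bullet> b) * ?Df (u x) b)) (at x)"
      if "x \<in> S" for x
      unfolding expand[OF that, symmetric]
      by (rule has_derivative_compose[OF Ck_on_Suc_has_derivative[OF Suc.prems(1) that] Df[OF that]])
    show "Ck_on k S (\<lambda>x. \<Sum>b\<in>Basis. (?Du x v \<bullet> b) * ?Df (u x) b)" for v
    proof (intro Ck_on_sum Ck_on_mult assms(1))
      fix b :: 'e
      show "Ck_on k S (\<lambda>x. ?Du x v \<bullet> b)"
        using Suc.prems(1)
        by (intro Ck_on_bounded_linear_comp[OF assms(1) bounded_linear_inner_left]) simp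
      show "Ck_on k S (\<lambda>x. ?Df (u x) b)"
        using Suc.prems Ck_on_Suc_imp by (intro Suc.IH) auto
    qed
  qed
qed

section \<open>Hadamard's lemma\<close>

lemma convex_homothety_mem:
  assumes "convex S" "a \<in> S" "x \<in> S" "t \<in> {0..1::real}"
  shows "a + t *\<^sub>R (x - a) \<in> S"
proof -
  have "a + t *\<^sub>R (x - a) = (1 - t) *\<^sub>R a + t *\<^sub>R x" by (simp add: algebra_simps)
  then show ?thesis using convexD_alt[OF assms(1-3), of t] assms(4) by simp
qed

lemma continuous_on_homothety:
  fixes F :: "'e::euclidean_space \<Rightarrow> real"
  assumes "convex S" "a \<in> S" "continuous_on S F"
  shows "continuous_on (S \<times> cbox 0 1) (\<lambda>(x, t). t ^ m * F (a + t *\<^sub>R (x - a)))"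
proof -
  have "continuous_on (S \<times> cbox 0 1) (\<lambda>z. F (a + snd z *\<^sub>R (fst z - a)))"
    by (rule continuous_on_compose2[OF assms(3)])
      (auto intro!: continuous_intros convex_homothety_mem[OF assms(1,2)])
  then show ?thesis unfolding split_beta by (intro continuous_on_mult continuous_on_power continuous_on_snd continuous_on_id)
qed

lemma continuous_on_homothety_segment:
  fixes F :: "'e::euclidean_space \<Rightarrow> real"
  assumes "convex S" "a \<in> S" "continuous_on S F" "x \<in> S"
  shows "continuous_on (cbox 0 1) (\<lambda>t. t ^ m * F (a + t *\<^sub>R (x - a)))"
proof -
  have "continuous_on (cbox 0 1) (\<lambda>t. F (a + t *\<^sub>R (x - a)))"
    by (rule continuous_on_compose2[OF assms(3)])
      (auto intro!: continuous_intros convex_homothety_mem[OF assms(1,2,4)])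
  then show ?thesis by (intro continuous_on_mult continuous_on_power continuous_on_id)
qed

text \<open>Differentiation under the integral sign replaces \<open>F\<close> by a directional derivative of \<open>F\<close> and
produces one more factor \<open>t\<close>. The weight \<open>t ^ m\<close> is there to make this an induction on \<open>k\<close>.\<close>

lemma Ck_on_segment_average:
  fixes F :: "'e::euclidean_space \<Rightarrow> real"
  assumes "open S" "convex S" "a \<in> S" "Ck_on k S F"
  shows "Ck_on k S (\<lambda>x. integral {0..1} (\<lambda>t. t ^ m * F (a + t *\<^sub>R (x - a))))"
  using assms(4)
proof (induction k arbitrary: F m)
  case (0 F m)
  have "continuous_on (S \<times> cbox 0 1) (\<lambda>(x, t). t ^ m * F (a + t *\<^sub>R (x - a)))"
    using 0 by (intro continuous_on_homothety[OF assms(2,3)]) simp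
  from integral_continuous_on_param[OF this] show ?case by simp
next
  case (Suc k F m)
  have inS: "a + t *\<^sub>R (x - a) \<in> S" if "x \<in> S" "t \<in> {0..1}" for x t
    by (rule convex_homothety_mem[OF assms(2,3) that])
  let ?DF = "\<lambda>y. frechet_derivative F (at y)"
  have DF: "(F has_derivative ?DF y) (at y)" if "y \<in> S" for y
    using Ck_on_Suc_has_derivative[OF Suc.prems that] .
  have cont_F: "continuous_on S F" using Suc.prems Ck_on_imp_continuous_on by blast
  have cont_DF: "continuous_on S (\<lambda>y. ?DF y v)" for v
    using Suc.prems Ck_on_imp_continuous_on by (metis Ck_on.simps(2))
  define f' where "f' = (\<lambda>x t. Blinfun (\<lambda>v. t ^ Suc m * ?DF (a + t *\<^sub>R (x - a)) v))"
  have bl: "bounded_linear (\<lambda>v. t ^ Suc m * ?DF (a + t *\<^sub>R (x - a)) v)"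
    if "x \<in> S" "t \<in> {0..1}" for x t
    by (rule bounded_linear_const_mult)
      (rule has_derivative_bounded_linear[OF DF[OF inS[OF that]]])
  have f'_apply: "blinfun_apply (f' x t) v = t ^ Suc m * ?DF (a + t *\<^sub>R (x - a)) v"
    if "x \<in> S" "t \<in> {0..1}" for x t v
    using bl[OF that] by (simp add: f'_def bounded_linear_Blinfun_apply)
  have cont': "continuous_on (S \<times> cbox 0 1) (\<lambda>(x, t). f' x t)"
  proof (rule continuous_on_blinfun_componentwise)
    fix v :: 'e
    have "continuous_on (S \<times> cbox 0 1) (\<lambda>(x, t). t ^ Suc m * ?DF (a + t *\<^sub>R (x - a)) v)"
      by (rule continuous_on_homothety[OF assms(2,3) cont_DF])
    then show "continuous_on (S \<times> cbox 0 1) (\<lambda>z. blinfun_apply (case z of (x, t) \<Rightarrow> f' x t) v)"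
      by (rule continuous_on_eq) (auto simp: f'_apply)
  qed
  have der: "((\<lambda>x. integral (cbox 0 1) (\<lambda>t. t ^ m * F (a + t *\<^sub>R (x - a)))) has_derivative
        blinfun_apply (integral (cbox 0 1) (f' x))) (at x within S)" if "x \<in> S" for x
  proof (rule leibniz_rule[OF _ _ cont' that assms(2)])
    show "((\<lambda>x. t ^ m * F (a + t *\<^sub>R (x - a))) has_derivative blinfun_apply (f' x t)) (at x within S)"
      if "x \<in> S" "t \<in> cbox 0 1" for x t
    proof -
      have "((\<lambda>x. a + t *\<^sub>R (x - a)) has_derivative (\<lambda>v. t *\<^sub>R v)) (at x)"
        by (auto intro!: derivative_eq_intros)
      then have "((\<lambda>x. F (a + t *\<^sub>R (x - a))) has_derivative
          (\<lambda>v. ?DF (a + t *\<^sub>R (x - a)) (t *\<^sub>R v))) (at x)"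
        by (rule has_derivative_compose) (rule DF[OF inS], use that in auto)
      then have "((\<lambda>x. t ^ m * F (a + t *\<^sub>R (x - a))) has_derivative
          (\<lambda>v. t ^ m * ?DF (a + t *\<^sub>R (x - a)) (t *\<^sub>R v))) (at x)"
        by (rule has_derivative_mult_right)
      moreover have "(\<lambda>v. t ^ m * ?DF (a + t *\<^sub>R (x - a)) (t *\<^sub>R v)) = blinfun_apply (f' x t)"
      proof
        fix v
        have "linear (?DF (a + t *\<^sub>R (x - a)))"
          using that by (intro bounded_linear.linear has_derivative_bounded_linear[OF DF] inS) auto
        then show "t ^ m * ?DF (a + t *\<^sub>R (x - a)) (t *\<^sub>R v) = blinfun_apply (f' x t) v"
          using that by (simp add: f'_apply linear_cmul)
      qed
      ultimately show ?thesis by (metis has_derivative_at_withinI)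
    qed
    show "(\<lambda>t. t ^ m * F (a + t *\<^sub>R (x - a))) integrable_on cbox 0 1" if "x \<in> S" for x
      by (intro integrable_continuous continuous_on_homothety_segment[OF assms(2,3) cont_F that])
  qed
  show ?case
  proof (rule Ck_on_SucI[OF assms(1)])
    fix x assume x: "x \<in> S"
    show "((\<lambda>x. integral {0..1} (\<lambda>t. t ^ m * F (a + t *\<^sub>R (x - a)))) has_derivative
      (\<lambda>v. integral {0..1} (\<lambda>t. t ^ Suc m * ?DF (a + t *\<^sub>R (x - a)) v))) (at x)"
    proof -
      have "f' x integrable_on cbox 0 1"
      proof (rule integrable_continuous)
        show "continuous_on (cbox 0 1) (f' x)"
          using x continuous_on_compose2[OF cont' continuous_on_Pair[OF continuous_on_const continuous_on_id],
              of x "cbox 0 1"] by auto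
      qed
      then have "blinfun_apply (integral (cbox 0 1) (f' x)) v
          = integral (cbox 0 1) (\<lambda>t. blinfun_apply (f' x t) v)" for v
        by (rule blinfun_apply_integral)
      also have "integral (cbox 0 1) (\<lambda>t. blinfun_apply (f' x t) v)
          = integral (cbox 0 1) (\<lambda>t. t ^ Suc m * ?DF (a + t *\<^sub>R (x - a)) v)" for v
        using x by (intro integral_cong) (auto simp: f'_apply)
      finally have eq: "blinfun_apply (integral (cbox 0 1) (f' x))
          = (\<lambda>v. integral (cbox 0 1) (\<lambda>t. t ^ Suc m * ?DF (a + t *\<^sub>R (x - a)) v))" by blast
      show ?thesis
        using der[OF x] unfolding eq at_within_open[OF x assms(1)] by simp
    qed
  next
    fix v
    show "Ck_on k S (\<lambda>x. integral {0..1} (\<lambda>t. t ^ Suc m * ?DF (a + t *\<^sub>R (x - a)) v))"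
      using Suc.IH[of "\<lambda>y. ?DF y v" "Suc m"] Suc.prems by simp
  qed
qed

text \<open>The functions \<open>G b\<close> are the averages of the partial derivatives of \<open>F\<close> over the segments from \<open>a\<close>;
the formula is the fundamental theorem of calculus on these segments.\<close>

lemma hadamard:
  fixes F :: "'e::euclidean_space \<Rightarrow> real"
  assumes "open S" "convex S" "a \<in> S" "smooth_on S F"
  obtains G where "\<forall>b. smooth_on S (G b)"
    and "\<forall>x\<in>S. F x = F a + (\<Sum>b\<in>Basis. ((x - a) \<bullet> b) * G b x)"
proof
  let ?DF = "\<lambda>y. frechet_derivative F (at y)"
  define G where "G = (\<lambda>b x. integral {0..1} (\<lambda>t. ?DF (a + t *\<^sub>R (x - a)) b))"
  have C1: "Ck_on (Suc k) S F" for k using assms(4) by (auto simp: smooth_on_def)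
  then have DF: "(F has_derivative ?DF y) (at y)" if "y \<in> S" for y
    using Ck_on_Suc_has_derivative that by blast
  have CDF: "Ck_on k S (\<lambda>y. ?DF y v)" for v k using C1 by simp
  show "\<forall>b. smooth_on S (G b)"
    using Ck_on_segment_average[OF assms(1-3) CDF, where m = 0] by (simp add: smooth_on_def G_def)
  show "\<forall>x\<in>S. F x = F a + (\<Sum>b\<in>Basis. ((x - a) \<bullet> b) * G b x)"
  proof
  fix x assume x: "x \<in> S"
  have inS: "a + t *\<^sub>R (x - a) \<in> S" if "t \<in> {0..1}" for t
    by (rule convex_homothety_mem[OF assms(2,3) x that])
  have "((\<lambda>t. F (a + t *\<^sub>R (x - a))) has_vector_derivative ?DF (a + t *\<^sub>R (x - a)) (x - a))
      (at t within {0..1})" if "t \<in> {0..1}" for t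
  proof -
    have "((\<lambda>t. a + t *\<^sub>R (x - a)) has_derivative (\<lambda>s. s *\<^sub>R (x - a))) (at t)"
      by (auto intro!: derivative_eq_intros)
    from has_derivative_compose[OF this DF[OF inS[OF that]]]
    have "((\<lambda>t. F (a + t *\<^sub>R (x - a))) has_derivative
      (\<lambda>s. ?DF (a + t *\<^sub>R (x - a)) (s *\<^sub>R (x - a)))) (at t)" .
    moreover have "linear (?DF (a + t *\<^sub>R (x - a)))"
      using that by (intro bounded_linear.linear has_derivative_bounded_linear[OF DF] inS) auto
    ultimately show ?thesis
      unfolding has_vector_derivative_def by (auto simp: linear_cmul intro: has_derivative_at_withinI)
  qed
  from fundamental_theorem_of_calculus[OF _ this]
  have I: "((\<lambda>t. ?DF (a + t *\<^sub>R (x - a)) (x - a)) has_integral (F x - F a)) {0..1}"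
    by simp
  have expand: "?DF (a + t *\<^sub>R (x - a)) (x - a)
      = (\<Sum>b\<in>Basis. ((x - a) \<bullet> b) * ?DF (a + t *\<^sub>R (x - a)) b)" if "t \<in> {0..1}" for t
  proof -
    have lin: "linear (?DF (a + t *\<^sub>R (x - a)))"
      using that by (intro bounded_linear.linear has_derivative_bounded_linear[OF DF] inS) auto
    have "?DF (a + t *\<^sub>R (x - a)) (\<Sum>b\<in>Basis. ((x - a) \<bullet> b) *\<^sub>R b)
        = (\<Sum>b\<in>Basis. ((x - a) \<bullet> b) *\<^sub>R ?DF (a + t *\<^sub>R (x - a)) b)"
      using lin by (simp add: linear_sum linear_cmul)
    then show ?thesis by (simp only: euclidean_representation real_scaleR_def)
  qed
  have int: "(\<lambda>t. ?DF (a + t *\<^sub>R (x - a)) b) integrable_on {0..1}" for b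
    unfolding cbox_interval[symmetric]
    using continuous_on_homothety_segment[OF assms(2,3) Ck_on_imp_continuous_on[OF CDF[of 0 b]] x, of 0]
    by (intro integrable_continuous) simp
  have "F x - F a = integral {0..1} (\<lambda>t. ?DF (a + t *\<^sub>R (x - a)) (x - a))"
    using I by (simp add: integral_unique)
  also have "\<dots> = integral {0..1} (\<lambda>t. \<Sum>b\<in>Basis. ((x - a) \<bullet> b) * ?DF (a + t *\<^sub>R (x - a)) b)"
    by (rule integral_cong) (rule expand)
  also have "\<dots> = (\<Sum>b\<in>Basis. ((x - a) \<bullet> b) * G b x)"
    using int by (subst integral_sum) (auto simp: G_def intro: integrable_on_mult_right)
  finally show "F x = F a + (\<Sum>b\<in>Basis. ((x - a) \<bullet> b) * G b x)" by simp
  qed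
qed

section \<open>Bump functions\<close>

text \<open>The functions \<open>P(1/t) exp(-1/t)\<close>, extended by zero to \<open>t \<le> 0\<close>, form a class that is closed under
differentiation. This is the reason for the polynomial factor: smoothness of the function with
\<open>P = 1\<close> then needs no formula for its higher derivatives.\<close>

definition flat_exp :: "real poly \<Rightarrow> real \<Rightarrow> real" where
  "flat_exp P t = (if t > 0 then poly P (1/t) * exp (-1/t) else 0)"

lemma poly_times_exp_neg_tendsto_0:
  "((\<lambda>s. poly P s * exp (- s)) \<longlongrightarrow> (0::real)) at_top"
proof -
  have "((\<lambda>s. \<Sum>i\<le>degree P. coeff P i * (s ^ i / exp s)) \<longlongrightarrow> (\<Sum>i\<le>degree P. coeff P i * 0)) at_top"
    by (intro tendsto_intros tendsto_power_div_exp_0)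
  then show ?thesis
    by (simp add: poly_altdef exp_minus divide_inverse sum_distrib_right mult.assoc)
qed

lemma flat_exp_has_derivative:
  "(flat_exp P has_real_derivative flat_exp ((P - pderiv P) * [:0, 0, 1:]) t) (at t)"
proof -
  consider "t > 0" | "t < 0" | "t = 0" by linarith
  then show ?thesis
  proof cases
    case 1
    have "((\<lambda>t. poly P (1/t) * exp (-1/t)) has_real_derivative
       flat_exp ((P - pderiv P) * [:0, 0, 1:]) t) (at t)"
      using 1 by (auto intro!: derivative_eq_intros poly_DERIV
          simp: flat_exp_def field_simps power2_eq_square)
    then show ?thesis
      by (rule has_field_derivative_transform_within_open[of _ _ _ "{0<..}"]) (use 1 in \<open>auto simp: flat_exp_def\<close>)
  next
    case 2
    have "((\<lambda>t. 0) has_real_derivative flat_exp ((P - pderiv P) * [:0, 0, 1:]) t) (at t)"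
      using 2 by (auto simp: flat_exp_def)
    then show ?thesis
      by (rule has_field_derivative_transform_within_open[of _ _ _ "{..<0}"]) (use 2 in \<open>auto simp: flat_exp_def\<close>)
  next
    case 3
    have "((\<lambda>h. flat_exp P h / h) \<longlongrightarrow> 0) (at 0)"
    proof (rule filterlim_split_at)
      show "((\<lambda>h. flat_exp P h / h) \<longlongrightarrow> 0) (at_left 0)"
        by (rule tendsto_eventually)
          (auto simp: flat_exp_def eventually_at_filter)
      have "((\<lambda>h. poly (pCons 0 P) (inverse h) * exp (- inverse h)) \<longlongrightarrow> 0) (at_right (0::real))"
        by (rule filterlim_compose[OF poly_times_exp_neg_tendsto_0 filterlim_inverse_at_top_right])
      then show "((\<lambda>h. flat_exp P h / h) \<longlongrightarrow> 0) (at_right 0)"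
        by (rule Lim_transform_eventually)
          (auto simp: flat_exp_def eventually_at_filter field_simps)
    qed
    then show ?thesis using 3 by (simp add: DERIV_def flat_exp_def)
  qed
qed

lemma smooth_on_flat_exp: "smooth_on UNIV (flat_exp P)"
proof -
  have "Ck_on k UNIV (flat_exp P)" for k
  proof (induction k arbitrary: P)
    case 0
    then show ?case
      using DERIV_isCont[OF flat_exp_has_derivative] by (auto intro: continuous_at_imp_continuous_on)
  next
    case (Suc k)
    show ?case
    proof (rule Ck_on_SucI)
      show "(flat_exp P has_derivative (\<lambda>v. flat_exp ((P - pderiv P) * [:0, 0, 1:]) t * v)) (at t)" for t
        using flat_exp_has_derivative by (simp add: has_field_derivative_def)
    qed (auto intro: Ck_on_mult Suc Ck_on_const)
  qed
  then show ?thesis by (simp add: smooth_on_def)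
qed

lemma smooth_bump:
  fixes a :: "'e::euclidean_space"
  assumes "r > 0"
  obtains \<beta> :: "'e \<Rightarrow> real" where "smooth_on UNIV \<beta>" "\<beta> a = 1" "\<forall>x. x \<notin> cball a r \<longrightarrow> \<beta> x = 0"
proof
  \<comment> \<open>\<open>q\<close> is \<open>r^2\<close> minus the squared distance from \<open>a\<close>, hence negative outside the ball.\<close>
  define q where "q x = r^2 + (- 1) * (\<Sum>b\<in>Basis. ((x - a) \<bullet> b) * ((x - a) \<bullet> b))" for x
  define \<beta> where "\<beta> = (\<lambda>x. inverse (flat_exp 1 (r^2)) * flat_exp 1 (q x))"
  have lin: "Ck_on k UNIV (\<lambda>x::'e. (x - a) \<bullet> b)" for k b
  proof -
    have "Ck_on k UNIV (\<lambda>x::'e. x \<bullet> b + (- a \<bullet> b))"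
      by (intro Ck_on_add Ck_on_const Ck_on_bounded_linear bounded_linear_inner_left) auto
    then show ?thesis by (simp add: inner_diff_left)
  qed
  have "Ck_on k UNIV q" for k
    unfolding q_def by (intro Ck_on_add Ck_on_mult Ck_on_sum Ck_on_const lin) auto
  then have "Ck_on k UNIV (\<lambda>x. flat_exp 1 (q x))" for k
    using smooth_on_flat_exp Ck_on_compose[of UNIV UNIV q k "flat_exp 1"] by (auto simp: smooth_on_def)
  then have "Ck_on k UNIV \<beta>" for k
    unfolding \<beta>_def by (intro Ck_on_mult Ck_on_const) auto
  then show "smooth_on UNIV \<beta>" by (simp add: smooth_on_def)
  show "\<beta> a = 1" using assms by (simp add: \<beta>_def q_def flat_exp_def)
  show "\<forall>x. x \<notin> cball a r \<longrightarrow> \<beta> x = 0"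
  proof (intro allI impI)
    fix x assume that: "x \<notin> cball a r"
    have "r < norm (x - a)" using that by (simp add: dist_norm norm_minus_commute)
    then have "r^2 < norm (x - a)^2" using assms by (simp add: power_strict_mono)
    then show "\<beta> x = 0"
      by (simp add: \<beta>_def q_def flat_exp_def power2_norm_eq_inner euclidean_inner[symmetric])
  qed
qed

section \<open>Smooth functions and tangent spaces\<close>

locale manifold =
  fixes A :: "('a::{t2_space,second_countable_topology}, 'e::euclidean_space) atlas"
  assumes smooth_manifold: "smooth_manifold A"
begin

lemma chart_open: "(U, c) \<in> A \<Longrightarrow> open U" "(U, c) \<in> A \<Longrightarrow> open (c ` U)"
  using smooth_manifold by (auto simp: smooth_manifold_def)

lemma chart_homeomorphism: "(U, c) \<in> A \<Longrightarrow> homeomorphism U (c ` U) c (inv_into U c)"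
  using smooth_manifold by (auto simp: smooth_manifold_def)

lemma chart_inverse:
  assumes "(U, c) \<in> A"
  shows "q \<in> U \<Longrightarrow> inv_into U c (c q) = q" "x \<in> c ` U \<Longrightarrow> c (inv_into U c x) = x"
    "x \<in> c ` U \<Longrightarrow> inv_into U c x \<in> U"
  using chart_homeomorphism[OF assms] by (auto simp: homeomorphism_def)

lemma chart_at: obtains U c where "(U, c) \<in> A" "p \<in> U"
proof -
  have "p \<in> (\<Union>(U, c)\<in>A. U)" using smooth_manifold by (simp add: smooth_manifold_def)
  then show ?thesis using that by auto
qed

lemma transition_Ck_on:
  assumes "(U, c) \<in> A" "(V, d) \<in> A"
  shows "Ck_on k (d ` (V \<inter> U)) (\<lambda>x. c (inv_into V d x))"
proof -
  have "\<forall>(U, c)\<in>A. \<forall>(V, d)\<in>A. smooth_on (c ` (U \<inter> V)) (d \<circ> inv_into U c)"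
    using smooth_manifold unfolding smooth_manifold_def by blast
  then have "smooth_on (d ` (V \<inter> U)) (c \<circ> inv_into V d)"
    using assms by (metis (no_types, lifting) case_prodD)
  then show ?thesis by (simp add: smooth_on_def comp_def)
qed

lemma smooth_funI:
  "(\<And>U c k. (U, c) \<in> A \<Longrightarrow> Ck_on k (c ` U) (\<lambda>x. f (inv_into U c x))) \<Longrightarrow> smooth_fun A f"
  by (auto simp: smooth_fun_def smooth_on_def comp_def)

lemma smooth_funD:
  assumes "smooth_fun A f" "(U, c) \<in> A"
  shows "Ck_on k (c ` U) (\<lambda>x. f (inv_into U c x))"
proof -
  have "smooth_on (c ` U) (f \<circ> inv_into U c)"
    using assms unfolding smooth_fun_def by (metis (no_types, lifting) case_prodD)
  then show ?thesis by (simp add: smooth_on_def comp_def)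
qed

named_theorems smooth_intros

lemma smooth_const [smooth_intros]: "smooth_fun A (\<lambda>q. c)"
  by (rule smooth_funI) (rule Ck_on_const)

lemma smooth_add [smooth_intros]:
  "smooth_fun A f \<Longrightarrow> smooth_fun A g \<Longrightarrow> smooth_fun A (\<lambda>q. f q + g q)"
  by (rule smooth_funI, rule Ck_on_add) (simp_all add: chart_open smooth_funD)

lemma smooth_mult [smooth_intros]:
  "smooth_fun A f \<Longrightarrow> smooth_fun A g \<Longrightarrow> smooth_fun A (\<lambda>q. f q * g q)"
  by (rule smooth_funI, rule Ck_on_mult) (simp_all add: chart_open smooth_funD)

lemma smooth_minus [smooth_intros]: "smooth_fun A f \<Longrightarrow> smooth_fun A (\<lambda>q. - f q)"
  using smooth_mult[OF smooth_const[of "-1"]] by simp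

lemma smooth_diff [smooth_intros]:
  "smooth_fun A f \<Longrightarrow> smooth_fun A g \<Longrightarrow> smooth_fun A (\<lambda>q. f q - g q)"
  using smooth_add[OF _ smooth_minus, of f g] by simp

lemma smooth_sum [smooth_intros]:
  "(\<And>i. i \<in> I \<Longrightarrow> smooth_fun A (f i)) \<Longrightarrow> smooth_fun A (\<lambda>q. \<Sum>i\<in>I. f i q)"
  by (induction I rule: infinite_finite_induct) (simp_all add: smooth_const smooth_add)

text \<open>The support of \<open>\<beta>\<close> is a closed ball inside the chart. Its image in the manifold is compact, hence
closed because the manifold is Hausdorff, and so a cut-off function can be extended by zero across
the boundary of the chart.\<close>

lemma chart_bump:
  obtains U c r \<beta> where "(U, c) \<in> A" "p \<in> U" "r > 0" "ball (c p) r \<subseteq> c ` U" "\<beta> (c p) = 1"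
    "\<forall>F. smooth_on (ball (c p) r) F \<longrightarrow>
       smooth_fun A (\<lambda>q. if q \<in> U \<and> c q \<in> ball (c p) r then \<beta> (c q) * F (c q) else 0)"
proof -
  obtain U c where Uc: "(U, c) \<in> A" "p \<in> U" by (rule chart_at)
  obtain r where r: "r > 0" "ball (c p) r \<subseteq> c ` U"
    by (rule openE[OF chart_open(2)[OF Uc(1)] imageI[OF Uc(2)]])
  obtain \<beta> :: "'e \<Rightarrow> real" where \<beta>: "smooth_on UNIV \<beta>" "\<beta> (c p) = 1" "\<forall>x. x \<notin> cball (c p) (r/2) \<longrightarrow> \<beta> x = 0"
    by (rule smooth_bump[OF half_gt_zero[OF r(1)], of "c p"])
  let ?B = "ball (c p) r" and ?K = "inv_into U c ` cball (c p) (r/2)"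
  let ?W = "c -` ?B \<inter> U"
  have "open ?W"
    using chart_homeomorphism[OF Uc(1)] open_ball
    unfolding homeomorphism_def continuous_on_open_vimage[OF chart_open(1)[OF Uc(1)]] by blast
  have sub: "cball (c p) (r/2) \<subseteq> ?B" using r(1) by auto
  have "continuous_on (c ` U) (inv_into U c)"
    using chart_homeomorphism[OF Uc(1)] by (simp add: homeomorphism_def)
  then have "compact ?K"
    by (rule compact_continuous_image[OF continuous_on_subset compact_cball]) (use sub r(2) in blast)
  then have "closed ?K" by (rule compact_imp_closed)
  have KW: "?K \<subseteq> ?W"
  proof
    fix q assume "q \<in> ?K"
    then obtain x where x: "x \<in> ?B" "q = inv_into U c x" using sub by blast
    then have "x \<in> c ` U" using r(2) by blast
    with x show "q \<in> ?W" using chart_inverse(2,3)[OF Uc(1)] by simp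
  qed
  show ?thesis
  proof (rule that[of U c r \<beta>, OF Uc r \<beta>(2)], intro allI impI)
    fix F :: "'e \<Rightarrow> real" assume F: "smooth_on ?B F"
    let ?G = "\<lambda>q. if q \<in> U \<and> c q \<in> ?B then \<beta> (c q) * F (c q) else 0"
    show "smooth_fun A ?G"
    proof (rule smooth_funI)
      fix V d k assume Vd: "(V, d) \<in> A"
      let ?i = "inv_into V d"
      have cont: "continuous_on (d ` V) ?i"
        using chart_homeomorphism[OF Vd] by (auto simp: homeomorphism_def)
      define S1 S2 where "S1 = ?i -` ?W \<inter> d ` V" and "S2 = ?i -` (- ?K) \<inter> d ` V"
      have S: "open S1" "open S2"
        using cont \<open>open ?W\<close> open_Compl[OF \<open>closed ?K\<close>]
        unfolding S1_def S2_def continuous_on_open_vimage[OF chart_open(2)[OF Vd]] by blast+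
      have "Ck_on k S1 (\<lambda>x. c (?i x))"
      proof (rule Ck_on_subset[OF transition_Ck_on[OF Uc(1) Vd]])
        show "S1 \<subseteq> d ` (V \<inter> U)"
        proof
          fix x assume "x \<in> S1"
          then have "?i x \<in> V \<inter> U" "d (?i x) = x"
            using chart_inverse(2,3)[OF Vd] by (auto simp: S1_def)
          then show "x \<in> d ` (V \<inter> U)" by (metis imageI)
        qed
      qed
      moreover have "(\<lambda>x. c (?i x)) ` S1 \<subseteq> ?B" by (auto simp: S1_def)
      moreover have "Ck_on k ?B (\<lambda>y. \<beta> y * F y)"
        using F \<beta>(1) by (intro Ck_on_mult) (simp_all add: smooth_on_def Ck_on_subset[of k UNIV])
      ultimately have "Ck_on k S1 (\<lambda>x. \<beta> (c (?i x)) * F (c (?i x)))"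
        using Ck_on_compose[OF S(1) open_ball, of "\<lambda>x. c (?i x)" _ _ k "\<lambda>y. \<beta> y * F y"] by blast
      then have "Ck_on k S1 (\<lambda>x. ?G (?i x))"
        by (rule Ck_on_cong[OF S(1), rotated]) (auto simp: S1_def)
      moreover have "Ck_on k S2 (\<lambda>x. ?G (?i x))"
      proof (rule Ck_on_cong[OF S(2)])
        fix x assume "x \<in> S2"
        then have "?i x \<notin> ?K" by (simp add: S2_def)
        then have "c (?i x) \<notin> cball (c p) (r/2)" if "?i x \<in> U"
          using imageI[of "c (?i x)" "cball (c p) (r/2)" "inv_into U c"]
          unfolding chart_inverse(1)[OF Uc(1) that] by blast
        then show "0 = ?G (?i x)" using \<beta>(3) by auto
      qed (rule Ck_on_const)
      moreover have "d ` V = S1 \<union> S2" using KW unfolding S1_def S2_def by blast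
      ultimately show "Ck_on k (d ` V) (\<lambda>x. ?G (?i x))" using Ck_on_Un[OF S, of k "\<lambda>x. ?G (?i x)"] by metis
    qed
  qed
qed

lemma tangent_add:
  "v \<in> tangent_space A p \<Longrightarrow> smooth_fun A f \<Longrightarrow> smooth_fun A g \<Longrightarrow> v (\<lambda>q. f q + g q) = v f + v g"
  by (simp add: tangent_space_def)

lemma tangent_cmult:
  "v \<in> tangent_space A p \<Longrightarrow> smooth_fun A f \<Longrightarrow> v (\<lambda>q. c * f q) = c * v f"
  by (simp add: tangent_space_def)

lemma tangent_mult:
  "v \<in> tangent_space A p \<Longrightarrow> smooth_fun A f \<Longrightarrow> smooth_fun A g \<Longrightarrow>
    v (\<lambda>q. f q * g q) = f p * v g + g p * v f"
  by (simp add: tangent_space_def)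

lemma tangent_not_smooth: "v \<in> tangent_space A p \<Longrightarrow> \<not> smooth_fun A f \<Longrightarrow> v f = 0"
  by (simp add: tangent_space_def)

lemma tangent_const:
  assumes "v \<in> tangent_space A p"
  shows "v (\<lambda>q. c) = 0"
  using tangent_mult[OF assms smooth_const smooth_const, of 1 1]
    tangent_cmult[OF assms smooth_const, of c 1] by simp

lemma tangent_minus:
  "v \<in> tangent_space A p \<Longrightarrow> smooth_fun A f \<Longrightarrow> v (\<lambda>q. - f q) = - v f"
  using tangent_cmult[of v p f "-1"] by simp

lemma tangent_diff:
  assumes "v \<in> tangent_space A p" "smooth_fun A f" "smooth_fun A g"
  shows "v (\<lambda>q. f q - g q) = v f - v g"
  using tangent_add[OF assms(1,2) smooth_minus[OF assms(3)]] tangent_minus[OF assms(1,3)] by simp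

lemma tangent_sum:
  assumes "v \<in> tangent_space A p" "\<And>i. i \<in> I \<Longrightarrow> smooth_fun A (f i)"
  shows "v (\<lambda>q. \<Sum>i\<in>I. f i q) = (\<Sum>i\<in>I. v (f i))"
  using assms(2)
proof (induction I rule: infinite_finite_induct)
  case (insert i I)
  then show ?case using tangent_add[OF assms(1), of "f i" "\<lambda>q. \<Sum>i\<in>I. f i q"]
    by (simp add: smooth_sum)
qed (simp_all add: tangent_const[OF assms(1)])

lemma subspace_tangent_space: "subspace (tangent_space A p)"
  unfolding subspace_def tangent_space_def by (auto simp: algebra_simps scaleR_fun_def)

text \<open>Let \<open>cut\<close> be a cut-off function with value \<open>1\<close> at \<open>p\<close>. A derivation at \<open>p\<close> takes the same value on
\<open>f\<close> and on \<open>cut * cut * (f - f p)\<close>, because \<open>f - f p\<close> vanishes at \<open>p\<close>. By Hadamard's lemma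
this product is a sum of products of two global smooth functions, the first of which is a cut-off coordinate function and vanishes at \<open>p\<close>;
one factor \<open>cut\<close> goes to each.\<close>

lemma tangent_determined_by_coordinates:
  obtains x :: "'e \<Rightarrow> 'a \<Rightarrow> real"
  where "\<forall>f. smooth_fun A f \<longrightarrow>
     (\<exists>a. \<forall>v\<in>tangent_space A p. v f = (\<Sum>b\<in>Basis. a b * v (x b)))"
proof -
  obtain U c r \<beta> where Uc: "(U, c) \<in> A" "p \<in> U" and r: "r > 0" "ball (c p) r \<subseteq> c ` U"
    and \<beta>: "\<beta> (c p) = 1"
    and ext: "\<forall>F. smooth_on (ball (c p) r) F \<longrightarrow>
       smooth_fun A (\<lambda>q. if q \<in> U \<and> c q \<in> ball (c p) r then \<beta> (c q) * F (c q) else 0)"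
    by (rule chart_bump[of p])
  let ?B = "ball (c p) r"
  define e where "e F = (\<lambda>q. if q \<in> U \<and> c q \<in> ?B then \<beta> (c q) * F (c q) else 0)" for F :: "'e \<Rightarrow> real"
  have e_smooth: "smooth_on ?B F \<Longrightarrow> smooth_fun A (e F)" for F
    using ext by (simp add: e_def)
  have e_p: "e F p = F (c p)" for F using Uc r \<beta> by (simp add: e_def)
  define X where "X b = e (\<lambda>y. (y - c p) \<bullet> b)" for b
  have "Ck_on k ?B (\<lambda>y. y \<bullet> b + (- (c p)) \<bullet> b)" for k b
    by (intro Ck_on_add Ck_on_const Ck_on_bounded_linear bounded_linear_inner_left) auto
  then have X_smooth: "smooth_fun A (X b)" for b
    unfolding X_def by (intro e_smooth) (simp add: smooth_on_def inner_diff_left)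
  have X_p: "X b p = 0" for b by (simp add: X_def e_p)
  define cut where "cut = e (\<lambda>_. 1)"
  have cut: "smooth_fun A cut" "cut p = 1"
    unfolding cut_def e_p by (auto intro!: e_smooth simp: smooth_on_def Ck_on_const)
  show ?thesis
  proof (rule that, intro allI impI)
    fix f assume f: "smooth_fun A f"
    have sm: "smooth_on ?B (\<lambda>x. f (inv_into U c x))"
      unfolding smooth_on_def using Ck_on_subset[OF smooth_funD[OF f Uc(1)] r(2)] by simp
    obtain G where G: "\<forall>b. smooth_on ?B (G b)"
      and had: "\<forall>x\<in>?B. f (inv_into U c x)
          = f (inv_into U c (c p)) + (\<Sum>b\<in>Basis. ((x - c p) \<bullet> b) * G b x)"
      by (rule hadamard[OF open_ball convex_ball centre_in_ball[THEN iffD2, OF r(1)] sm])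
    \<comment> \<open>Outside the ball both sides vanish, because every extended function does.\<close>
    have key: "(\<lambda>q. (cut q * cut q) * (f q - f p)) = (\<lambda>q. \<Sum>b\<in>Basis. X b q * e (G b) q)"
    proof
      fix q
      show "(cut q * cut q) * (f q - f p) = (\<Sum>b\<in>Basis. X b q * e (G b) q)"
      proof (cases "q \<in> U \<and> c q \<in> ?B")
        case True
        then have "f q - f p = (\<Sum>b\<in>Basis. ((c q - c p) \<bullet> b) * G b (c q))"
          using bspec[OF had, of "c q"] Uc chart_inverse(1)[OF Uc(1)] by simp
        then show ?thesis
          using True by (simp add: cut_def X_def e_def sum_distrib_left mult_ac)
      qed (auto simp: cut_def X_def e_def)
    qed
    have "v f = (\<Sum>b\<in>Basis. G b (c p) * v (X b))" if v: "v \<in> tangent_space A p" for v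
    proof -
      have "v f = v (\<lambda>q. f q - f p)"
        using tangent_diff[OF v f smooth_const] tangent_const[OF v] by simp
      also have "\<dots> = v (\<lambda>q. (cut q * cut q) * (f q - f p))"
        using tangent_mult[OF v smooth_mult[OF cut(1) cut(1)] smooth_diff[OF f smooth_const]] cut(2)
        by simp
      also have "\<dots> = (\<Sum>b\<in>Basis. v (\<lambda>q. X b q * e (G b) q))"
        unfolding key by (rule tangent_sum[OF v]) (rule smooth_mult[OF X_smooth e_smooth[OF spec[OF G]]])
      also have "\<dots> = (\<Sum>b\<in>Basis. G b (c p) * v (X b))"
        unfolding tangent_mult[OF v X_smooth e_smooth[OF spec[OF G]]] X_p e_p by simp
      finally show ?thesis .
    qed
    then show "\<exists>a. \<forall>v\<in>tangent_space A p. v f = (\<Sum>b\<in>Basis. a b * v (X b))"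
      by (intro exI[of _ "\<lambda>b. G b (c p)"] ballI)
  qed
qed

text \<open>The values of a tangent vector on the cut-off coordinates embed the tangent space linearly into the
Euclidean space \<open>'e\<close>, and the image of an independent set of full cardinality spans there.\<close>

lemma tangent_space_eq_span:
  assumes "B \<subseteq> tangent_space A p" "finite B" "independent B" "card B = DIM('e)"
  shows "tangent_space A p = span B"
proof
  show "span B \<subseteq> tangent_space A p"
    using assms(1) subspace_tangent_space by (rule span_minimal)
  obtain x :: "'e \<Rightarrow> 'a \<Rightarrow> real" where x: "\<forall>f. smooth_fun A f \<longrightarrow>
     (\<exists>a. \<forall>v\<in>tangent_space A p. v f = (\<Sum>b\<in>Basis. a b * v (x b)))"
    by (rule tangent_determined_by_coordinates[of p])
  define L where "L v = (\<Sum>b\<in>Basis. v (x b) *\<^sub>R b)" for v :: "'a tvec"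
  have "linear L"
    by (rule linearI) (simp_all add: L_def scaleR_add_left sum.distrib scaleR_sum_right scaleR_fun_def)
  have inj: "inj_on L (tangent_space A p)"
  proof (rule inj_onI)
    fix v w assume vw: "v \<in> tangent_space A p" "w \<in> tangent_space A p" "L v = L w"
    have "v (x b) = w (x b)" if "b \<in> Basis" for b
      using arg_cong[OF vw(3), of "\<lambda>u. u \<bullet> b"] that
      by (simp add: L_def inner_sum_left_Basis)
    then have xb: "(\<Sum>b\<in>Basis. a b * v (x b)) = (\<Sum>b\<in>Basis. a b * w (x b))" for a
      by simp
    show "v = w"
    proof
      fix f
      show "v f = w f"
      proof (cases "smooth_fun A f")
        case True
        then obtain a where a: "\<forall>v\<in>tangent_space A p. v f = (\<Sum>b\<in>Basis. a b * v (x b))"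
          using x by blast
        show ?thesis using bspec[OF a vw(1)] bspec[OF a vw(2)] xb[of a] by simp
      qed (use vw(1,2) in \<open>simp add: tangent_not_smooth\<close>)
    qed
  qed
  have sub: "span B \<subseteq> tangent_space A p" by fact
  have ind: "independent (L ` B)"
    using linear_independent_injective_image[OF \<open>linear L\<close> assms(3)] inj_on_subset[OF inj sub] by blast
  have "card (L ` B) = DIM('e)"
    using assms card_image inj_on_subset[OF inj assms(1)] by metis
  then have "UNIV \<subseteq> span (L ` B)"
    using card_ge_dim_independent[OF _ ind, of UNIV] by simp
  then have span: "L ` span B = UNIV" using linear_span_image[OF \<open>linear L\<close>] by auto
  show "tangent_space A p \<subseteq> span B"
  proof
    fix v assume v: "v \<in> tangent_space A p"
    obtain w where "w \<in> span B" "L v = L w" using span by (metis UNIV_I imageE)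
    then show "v \<in> span B" using inj_onD[OF inj] v sub by blast
  qed
qed

section \<open>Vector fields and their brackets\<close>

abbreviation "VF \<equiv> vector_fields A"

named_theorems vf_intros

lemma vf_tangent: "X \<in> VF \<Longrightarrow> X p \<in> tangent_space A p"
  by (simp add: vector_fields_def)

lemma smooth_deriv_along [smooth_intros]:
  "X \<in> VF \<Longrightarrow> smooth_fun A f \<Longrightarrow> smooth_fun A (deriv_along X f)"
  by (simp add: vector_fields_def)

lemma deriv_along_not_smooth: "X \<in> VF \<Longrightarrow> \<not> smooth_fun A f \<Longrightarrow> deriv_along X f = (\<lambda>p. 0)"
  by (auto simp: deriv_along_def intro: tangent_not_smooth vf_tangent)

lemma deriv_along_const: "X \<in> VF \<Longrightarrow> deriv_along X (\<lambda>q. c) = (\<lambda>p. 0)"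
  by (auto simp: deriv_along_def intro: tangent_const vf_tangent)

lemma deriv_along_add:
  "X \<in> VF \<Longrightarrow> smooth_fun A f \<Longrightarrow> smooth_fun A g \<Longrightarrow>
    deriv_along X (\<lambda>q. f q + g q) = (\<lambda>p. deriv_along X f p + deriv_along X g p)"
  by (auto simp: deriv_along_def intro: tangent_add vf_tangent)

lemma deriv_along_diff:
  "X \<in> VF \<Longrightarrow> smooth_fun A f \<Longrightarrow> smooth_fun A g \<Longrightarrow>
    deriv_along X (\<lambda>q. f q - g q) = (\<lambda>p. deriv_along X f p - deriv_along X g p)"
  by (auto simp: deriv_along_def intro: tangent_diff vf_tangent)

lemma deriv_along_minus:
  "X \<in> VF \<Longrightarrow> smooth_fun A f \<Longrightarrow> deriv_along X (\<lambda>q. - f q) = (\<lambda>p. - deriv_along X f p)"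
  by (auto simp: deriv_along_def intro: tangent_minus vf_tangent)

lemma deriv_along_mult:
  "X \<in> VF \<Longrightarrow> smooth_fun A f \<Longrightarrow> smooth_fun A g \<Longrightarrow>
    deriv_along X (\<lambda>q. f q * g q) = (\<lambda>p. f p * deriv_along X g p + g p * deriv_along X f p)"
  by (auto simp: deriv_along_def intro: tangent_mult vf_tangent)

lemmas deriv_along_rules =
  deriv_along_const deriv_along_add deriv_along_diff deriv_along_minus deriv_along_mult

lemma deriv_along_field:
  "deriv_along (X + Y) f = (\<lambda>p. deriv_along X f p + deriv_along Y f p)"
  "deriv_along (X - Y) f = (\<lambda>p. deriv_along X f p - deriv_along Y f p)"
  "deriv_along (fmult u X) f = (\<lambda>p. u p * deriv_along X f p)"
  "deriv_along 0 f = (\<lambda>p. 0)"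
  by (simp_all add: deriv_along_def fmult_def scaleR_fun_def)

lemma vf_add [vf_intros]: "X \<in> VF \<Longrightarrow> Y \<in> VF \<Longrightarrow> X + Y \<in> VF"
  by (simp add: vector_fields_def deriv_along_field smooth_add subspace_add[OF subspace_tangent_space])

lemma vf_diff [vf_intros]: "X \<in> VF \<Longrightarrow> Y \<in> VF \<Longrightarrow> X - Y \<in> VF"
  by (simp add: vector_fields_def deriv_along_field smooth_diff subspace_diff[OF subspace_tangent_space])

lemma vf_zero [vf_intros]: "0 \<in> VF"
  by (simp add: vector_fields_def deriv_along_field smooth_const subspace_0[OF subspace_tangent_space])

lemma vf_fmult [vf_intros]: "smooth_fun A u \<Longrightarrow> X \<in> VF \<Longrightarrow> fmult u X \<in> VF"
  by (simp add: vector_fields_def deriv_along_field smooth_mult)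
    (simp add: fmult_def subspace_scale[OF subspace_tangent_space])

lemma vf_sum [vf_intros]: "(\<And>i. i \<in> I \<Longrightarrow> X i \<in> VF) \<Longrightarrow> (\<Sum>i\<in>I. X i) \<in> VF"
  by (induction I rule: infinite_finite_induct) (simp_all add: vf_zero vf_add)

lemma fmult_apply: "fmult u X p f = u p * X p f"
  by (simp add: fmult_def scaleR_fun_def)

lemma fmult_zero: "fmult (\<lambda>p. 0) X = 0"
  by (intro ext) (simp add: fmult_apply)

lemma fmult_field_zero: "fmult u 0 = 0"
  by (intro ext) (simp add: fmult_apply)

lemma scaleR_eq_fmult: "c *\<^sub>R X = fmult (\<lambda>p. c) X"
  by (simp add: fmult_def scaleR_fun_def)

lemma lie_bracket_apply: "lie_bracket X Y p f = deriv_along X (deriv_along Y f) p - deriv_along Y (deriv_along X f) p"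
  by (simp add: lie_bracket_def deriv_along_def)

lemma deriv_along_lie_bracket:
  "deriv_along (lie_bracket X Y) f
    = (\<lambda>p. deriv_along X (deriv_along Y f) p - deriv_along Y (deriv_along X f) p)"
  by (simp add: lie_bracket_def deriv_along_def)

lemma vf_lie_bracket [vf_intros]:
  assumes "X \<in> VF" "Y \<in> VF"
  shows "lie_bracket X Y \<in> VF"
proof -
  have "lie_bracket X Y p \<in> tangent_space A p" for p
    unfolding tangent_space_def mem_Collect_eq lie_bracket_apply
  proof (intro conjI allI impI)
    fix f :: "'a \<Rightarrow> real" and c
    assume "\<not> smooth_fun A f"
    then show "deriv_along X (deriv_along Y f) p - deriv_along Y (deriv_along X f) p = 0"
      using assms by (simp add: deriv_along_not_smooth deriv_along_const)
  next
    fix f g :: "'a \<Rightarrow> real" and c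
    assume f: "smooth_fun A f"
    then show "deriv_along X (deriv_along Y (\<lambda>q. c * f q)) p - deriv_along Y (deriv_along X (\<lambda>q. c * f q)) p
        = c * (deriv_along X (deriv_along Y f) p - deriv_along Y (deriv_along X f) p)"
      using assms by (simp add: deriv_along_rules smooth_intros algebra_simps)
    assume g: "smooth_fun A g"
    show "deriv_along X (deriv_along Y (\<lambda>q. f q + g q)) p - deriv_along Y (deriv_along X (\<lambda>q. f q + g q)) p
        = deriv_along X (deriv_along Y f) p - deriv_along Y (deriv_along X f) p +
          (deriv_along X (deriv_along Y g) p - deriv_along Y (deriv_along X g) p)"
      using assms f g by (simp add: deriv_along_rules smooth_intros algebra_simps)
    show "deriv_along X (deriv_along Y (\<lambda>q. f q * g q)) p - deriv_along Y (deriv_along X (\<lambda>q. f q * g q)) p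
        = f p * (deriv_along X (deriv_along Y g) p - deriv_along Y (deriv_along X g) p) +
          g p * (deriv_along X (deriv_along Y f) p - deriv_along Y (deriv_along X f) p)"
      using assms f g by (simp add: deriv_along_rules smooth_intros algebra_simps)
  qed
  moreover have "smooth_fun A (deriv_along (lie_bracket X Y) f)" if "smooth_fun A f" for f
    unfolding deriv_along_lie_bracket
    by (intro smooth_diff smooth_deriv_along assms that)
  ultimately show ?thesis unfolding vector_fields_def by blast
qed

lemma lie_bracket_commute: "lie_bracket Y X = - lie_bracket X Y"
  by (intro ext) (simp add: lie_bracket_apply)

lemma lie_bracket_self: "lie_bracket X X = 0"
  by (intro ext) (simp add: lie_bracket_apply)

lemma lie_bracket_fmult_right:
  assumes "X \<in> VF" "Y \<in> VF" "smooth_fun A u"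
  shows "lie_bracket X (fmult u Y) = fmult (deriv_along X u) Y + fmult u (lie_bracket X Y)"
proof (intro ext)
  fix p :: 'a and f
  have Y: "Y p f = deriv_along Y f p" by (simp add: deriv_along_def)
  show "lie_bracket X (fmult u Y) p f = (fmult (deriv_along X u) Y + fmult u (lie_bracket X Y)) p f"
    using assms
    by (cases "smooth_fun A f")
      (simp_all add: lie_bracket_apply fmult_apply Y deriv_along_field deriv_along_rules smooth_intros
        deriv_along_not_smooth algebra_simps)
qed

lemma lie_bracket_add_right:
  assumes "X \<in> VF" "Y \<in> VF" "Z \<in> VF"
  shows "lie_bracket X (Y + Z) = lie_bracket X Y + lie_bracket X Z"
proof (intro ext)
  fix p f
  show "lie_bracket X (Y + Z) p f = (lie_bracket X Y + lie_bracket X Z) p f"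
    using assms
    by (cases "smooth_fun A f")
      (simp_all add: lie_bracket_apply deriv_along_field deriv_along_rules smooth_intros
        deriv_along_not_smooth algebra_simps)
qed

lemma lie_bracket_fmult_left:
  assumes "X \<in> VF" "Y \<in> VF" "smooth_fun A u"
  shows "lie_bracket (fmult u X) Y = fmult u (lie_bracket X Y) - fmult (deriv_along Y u) X"
  unfolding lie_bracket_commute[of "fmult u X"] lie_bracket_fmult_right[OF assms(2,1,3)]
    lie_bracket_commute[of X Y]
  by (intro ext) (simp add: fmult_apply)

lemma lie_bracket_add_left:
  assumes "X \<in> VF" "Y \<in> VF" "Z \<in> VF"
  shows "lie_bracket (X + Y) Z = lie_bracket X Z + lie_bracket Y Z"
  unfolding lie_bracket_commute[of "X + Y"] lie_bracket_add_right[OF assms(3,1,2)]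
    lie_bracket_commute[of X Z] lie_bracket_commute[of Y Z]
  by (intro ext) (simp add: fmult_apply)

lemma app_endo_add:
  "fibre_endomorphism A \<psi> \<Longrightarrow> X \<in> VF \<Longrightarrow> Y \<in> VF \<Longrightarrow>
    app_endo \<psi> (X + Y) = app_endo \<psi> X + app_endo \<psi> Y"
  by (intro ext) (simp add: app_endo_def fibre_endomorphism_def fibre_linear_def vf_tangent)

lemma app_endo_fmult:
  "fibre_endomorphism A \<psi> \<Longrightarrow> X \<in> VF \<Longrightarrow> app_endo \<psi> (fmult u X) = fmult u (app_endo \<psi> X)"
  by (rule ext) (simp add: app_endo_def fibre_endomorphism_def fibre_linear_def vf_tangent fmult_def)

end

section \<open>Riemannian metrics and the Koszul formula\<close>

locale riemannian_manifold = manifold A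
  for A :: "('a::{t2_space,second_countable_topology}, 'e::euclidean_space) atlas" +
  fixes g :: "'a bilin"
  assumes metric: "riemannian_metric A g"
begin

abbreviation "G \<equiv> pair_bilin g"

lemma smooth_metric [smooth_intros]: "X \<in> VF \<Longrightarrow> Y \<in> VF \<Longrightarrow> smooth_fun A (G X Y)"
  using metric by (simp add: riemannian_metric_def)

lemma metric_commute: "X \<in> VF \<Longrightarrow> Y \<in> VF \<Longrightarrow> G X Y = G Y X"
  using metric by (intro ext) (simp add: riemannian_metric_def fibre_symmetric_bilinear_def pair_bilin_def vf_tangent)

lemma metric_add_left: "X \<in> VF \<Longrightarrow> Y \<in> VF \<Longrightarrow> Z \<in> VF \<Longrightarrow> G (X + Y) Z = (\<lambda>p. G X Z p + G Y Z p)"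
  using metric by (intro ext) (simp add: riemannian_metric_def fibre_symmetric_bilinear_def pair_bilin_def vf_tangent)

lemma metric_fmult_left: "X \<in> VF \<Longrightarrow> Y \<in> VF \<Longrightarrow> G (fmult u X) Y = (\<lambda>p. u p * G X Y p)"
  using metric by (intro ext) (simp add: riemannian_metric_def fibre_symmetric_bilinear_def pair_bilin_def vf_tangent fmult_def)

lemma metric_diff_left:
  assumes "X \<in> VF" "Y \<in> VF" "Z \<in> VF"
  shows "G (X - Y) Z = (\<lambda>p. G X Z p - G Y Z p)"
  using metric_add_left[OF assms(1) vf_fmult[OF smooth_const assms(2)] assms(3), of "-1"]
    metric_fmult_left[OF assms(2,3), of "\<lambda>p. -1"]
  by (simp add: fmult_def plus_fun_def fun_diff_def)

lemma metric_minus_left: "X \<in> VF \<Longrightarrow> Y \<in> VF \<Longrightarrow> G (- X) Y = (\<lambda>p. - G X Y p)"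
  using metric_diff_left[of 0 X Y] metric_diff_left[of X X Y] by (simp add: vf_zero)

lemma metric_zero_left: "X \<in> VF \<Longrightarrow> G 0 X = (\<lambda>p. 0)"
  using metric_diff_left[of X X X] by simp

lemma metric_add_right: "X \<in> VF \<Longrightarrow> Y \<in> VF \<Longrightarrow> Z \<in> VF \<Longrightarrow> G Z (X + Y) = (\<lambda>p. G Z X p + G Z Y p)"
  by (simp add: metric_commute[of Z] metric_add_left vf_add)

lemma metric_diff_right: "X \<in> VF \<Longrightarrow> Y \<in> VF \<Longrightarrow> Z \<in> VF \<Longrightarrow> G Z (X - Y) = (\<lambda>p. G Z X p - G Z Y p)"
  by (simp add: metric_commute[of Z] metric_diff_left vf_diff)

lemma metric_fmult_right:
  assumes "X \<in> VF" "Y \<in> VF" "smooth_fun A u"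
  shows "G Y (fmult u X) = (\<lambda>p. u p * G Y X p)"
  using assms by (simp add: metric_commute[of Y] metric_fmult_left vf_fmult)

lemmas metric_rules = metric_add_left metric_fmult_left metric_diff_left
  metric_add_right metric_fmult_right metric_diff_right

lemma metric_nondegenerate:
  assumes "X \<in> VF" "Y \<in> VF" "\<And>Z p. Z \<in> VF \<Longrightarrow> G X Z p = G Y Z p"
  shows "X = Y"
proof (rule ext, rule ccontr)
  fix p assume "X p \<noteq> Y p"
  then have "(X - Y) p \<noteq> 0" by simp
  moreover have "X - Y \<in> VF" using assms by (intro vf_diff)
  ultimately have "G (X - Y) (X - Y) p > 0"
    using metric vf_tangent[of "X - Y" p] unfolding riemannian_metric_def pair_bilin_def by simp
  then show False
    using assms(3)[OF \<open>X - Y \<in> VF\<close>, of p] assms(1,2) by (simp add: metric_rules vf_diff)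
qed

lemma metric_at_add:
  "u \<in> tangent_space A p \<Longrightarrow> v \<in> tangent_space A p \<Longrightarrow> w \<in> tangent_space A p \<Longrightarrow>
    g p (u + v) w = g p u w + g p v w"
  using metric by (simp add: riemannian_metric_def fibre_symmetric_bilinear_def)

lemma metric_at_scale:
  "v \<in> tangent_space A p \<Longrightarrow> w \<in> tangent_space A p \<Longrightarrow> g p (c *\<^sub>R v) w = c * g p v w"
  using metric by (simp add: riemannian_metric_def fibre_symmetric_bilinear_def)

lemma metric_at_sum:
  assumes "finite B" "B \<subseteq> tangent_space A p" "w \<in> tangent_space A p"
  shows "g p (\<Sum>b\<in>B. u b *\<^sub>R b) w = (\<Sum>b\<in>B. u b * g p b w)"
  using assms(1,2)
proof (induction B rule: finite_induct)
  case empty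
  have "g p 0 w = 0"
    using metric_at_scale[OF assms(3,3), of 0] by (simp only: scaleR_zero_left mult_zero_left)
  then show ?case by (simp only: sum.empty)
next
  case (insert b B)
  let ?s = "\<Sum>b\<in>B. u b *\<^sub>R b"
  have b: "b \<in> tangent_space A p" using insert.prems by simp
  have ub: "u b *\<^sub>R b \<in> tangent_space A p" by (rule subspace_scale[OF subspace_tangent_space b])
  have s: "?s \<in> tangent_space A p"
    using insert.prems by (intro subspace_sum subspace_scale subspace_tangent_space) auto
  have "g p (u b *\<^sub>R b + ?s) w = u b * g p b w + g p ?s w"
    unfolding metric_at_add[OF ub s assms(3)] metric_at_scale[OF b assms(3)] ..
  then have "g p (u b *\<^sub>R b + ?s) w = u b * g p b w + (\<Sum>b\<in>B. u b * g p b w)"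
    using insert.IH insert.prems by simp
  then show ?case by (simp only: sum.insert[OF insert.hyps])
qed

text \<open>Orthonormal vectors are independent, and by the choice of the cardinality they span the tangent
space at \<open>p\<close>; the coefficients are then read off with the metric.\<close>

lemma orthonormal_frame_expansion:
  fixes e :: "'i \<Rightarrow> 'a vfield"
  assumes "finite I" "card I = DIM('e)" and e: "\<And>i. i \<in> I \<Longrightarrow> e i \<in> VF"
    and on: "\<And>i j. i \<in> I \<Longrightarrow> j \<in> I \<Longrightarrow> G (e i) (e j) p = (if i = j then 1 else 0)"
    and v: "v \<in> tangent_space A p"
  shows "v = (\<Sum>i\<in>I. g p v (e i p) *\<^sub>R e i p)"
proof -
  let ?B = "(\<lambda>i. e i p) ` I"
  have on': "g p (e i p) (e j p) = (if i = j then 1 else 0)" if "i \<in> I" "j \<in> I" for i j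
    using on[OF that] by (simp add: pair_bilin_def)
  have inj: "inj_on (\<lambda>i. e i p) I"
  proof (rule inj_onI)
    fix i j assume ij: "i \<in> I" "j \<in> I" "e i p = e j p"
    show "i = j" using on'[OF ij(1,1)] on'[OF ij(1,2)] unfolding ij(3) by (simp split: if_splits)
  qed
  have B: "finite ?B" "?B \<subseteq> tangent_space A p" "card ?B = DIM('e)"
    using assms(1,2) vf_tangent[OF e] card_image[OF inj] by auto
  have coeff: "g p (\<Sum>b\<in>?B. u b *\<^sub>R b) (e j p) = u (e j p)" if "j \<in> I" for u j
  proof -
    have "g p (\<Sum>b\<in>?B. u b *\<^sub>R b) (e j p) = (\<Sum>b\<in>?B. u b * g p b (e j p))"
      by (rule metric_at_sum[OF B(1,2) vf_tangent[OF e[OF that]]])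
    also have "\<dots> = (\<Sum>i\<in>I. u (e i p) * g p (e i p) (e j p))"
      by (simp add: sum.reindex[OF inj])
    also have "\<dots> = (\<Sum>i\<in>I. if i = j then u (e j p) else 0)"
      by (rule sum.cong) (simp_all add: on' that)
    also have "\<dots> = u (e j p)" using assms(1) that by simp
    finally show ?thesis .
  qed
  have "independent ?B"
  proof
    assume "dependent ?B"
    then obtain u b where u: "b \<in> ?B" "u b \<noteq> 0" "(\<Sum>b\<in>?B. u b *\<^sub>R b) = 0"
      unfolding dependent_finite[OF B(1)] by blast
    then obtain j where "j \<in> I" "b = e j p" by blast
    moreover have "(\<Sum>b\<in>?B. 0 *\<^sub>R b) = (0 :: 'a tvec)" by simp
    ultimately show False using coeff[of j u] coeff[of j "\<lambda>_. 0"] u(2,3) by simp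
  qed
  then have "v \<in> span ?B" using tangent_space_eq_span[OF B(2,1) _ B(3)] v by simp
  then obtain u where u: "v = (\<Sum>b\<in>?B. u b *\<^sub>R b)" unfolding span_finite[OF B(1)] by blast
  also have "\<dots> = (\<Sum>i\<in>I. u (e i p) *\<^sub>R e i p)" by (simp add: sum.reindex[OF inj])
  also have "\<dots> = (\<Sum>i\<in>I. g p v (e i p) *\<^sub>R e i p)"
    using coeff[of _ u] unfolding u[symmetric] by simp
  finally show ?thesis .
qed

text \<open>Twice the inner product of \<open>\<nabla>\<^sub>X Y\<close> and \<open>Z\<close>, expressed without the connection.\<close>

definition koszul :: "'a vfield \<Rightarrow> 'a vfield \<Rightarrow> 'a vfield \<Rightarrow> 'a \<Rightarrow> real" where
  "koszul X Y Z p = deriv_along X (G Y Z) p + deriv_along Y (G X Z) p - deriv_along Z (G X Y) p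
     + G (lie_bracket X Y) Z p - G (lie_bracket X Z) Y p - G (lie_bracket Y Z) X p"

lemmas koszul_simps = deriv_along_rules deriv_along_field metric_rules vf_intros smooth_intros
  lie_bracket_add_left lie_bracket_add_right lie_bracket_fmult_left lie_bracket_fmult_right

lemma koszul_torsion:
  assumes "X \<in> VF" "Y \<in> VF" "Z \<in> VF"
  shows "koszul X Y Z p - koszul Y X Z p = 2 * G (lie_bracket X Y) Z p"
  using assms
  by (simp add: koszul_def koszul_simps lie_bracket_commute[of Y X] metric_minus_left metric_commute[of Y X])

lemma koszul_compatible:
  assumes "X \<in> VF" "Y \<in> VF" "Z \<in> VF"
  shows "koszul X Y Z p + koszul X Z Y p = 2 * deriv_along X (G Y Z) p"
  using assms
  by (simp add: koszul_def koszul_simps lie_bracket_commute[of Z Y] metric_minus_left metric_commute[of Z Y])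

lemma koszul_add:
  assumes "X \<in> VF" "Y \<in> VF" "Z \<in> VF" "W \<in> VF"
  shows "koszul (X + W) Y Z p = koszul X Y Z p + koszul W Y Z p"
    and "koszul X (Y + W) Z p = koszul X Y Z p + koszul X W Z p"
    and "koszul X Y (Z + W) p = koszul X Y Z p + koszul X Y W p"
  using assms by (simp_all add: koszul_def koszul_simps algebra_simps)

text \<open>The terms with a derivative of \<open>u\<close> cancel in the first and third argument; in the second argument
the remaining one is the Leibniz term of a connection.\<close>

lemma koszul_fmult:
  assumes "X \<in> VF" "Y \<in> VF" "Z \<in> VF" "smooth_fun A u"
  shows "koszul (fmult u X) Y Z p = u p * koszul X Y Z p"
    and "koszul X (fmult u Y) Z p = u p * koszul X Y Z p + 2 * deriv_along X u p * G Y Z p"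
    and "koszul X Y (fmult u Z) p = u p * koszul X Y Z p"
  using assms
  by (simp_all add: koszul_def koszul_simps metric_commute[of Y X] metric_commute[of Z X]
      metric_commute[of Z Y] algebra_simps)

lemma smooth_koszul:
  "X \<in> VF \<Longrightarrow> Y \<in> VF \<Longrightarrow> Z \<in> VF \<Longrightarrow> smooth_fun A (koszul X Y Z)"
  unfolding koszul_def[abs_def] by (simp add: koszul_simps)

text \<open>Metric compatibility turns the three derivatives in the Koszul expression into six inner products,
and vanishing torsion turns the three brackets into six more; all but two equal ones cancel.\<close>

lemma levi_civita_connection_koszul:
  assumes D: "levi_civita_connection A g D" and V: "X \<in> VF" "Y \<in> VF" "Z \<in> VF"
  shows "2 * G (D X Y) Z p = koszul X Y Z p"
proof -
  have DV: "U \<in> VF \<Longrightarrow> W \<in> VF \<Longrightarrow> D U W \<in> VF" for U W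
    using D by (simp add: levi_civita_connection_def affine_connection_def)
  have br: "U \<in> VF \<Longrightarrow> W \<in> VF \<Longrightarrow> lie_bracket U W = D U W - D W U" for U W
    using D by (simp add: levi_civita_connection_def)
  have comp: "U \<in> VF \<Longrightarrow> W \<in> VF \<Longrightarrow> T \<in> VF \<Longrightarrow>
      deriv_along U (G W T) p = G (D U W) T p + G W (D U T) p" for U W T
    using D by (simp add: levi_civita_connection_def)
  show ?thesis
    using V by (simp add: koszul_def br comp DV metric_rules
        metric_commute[of Y "D X Z"] metric_commute[of X "D Y Z"] metric_commute[of X "D Z Y"])
qed

lemma levi_civita_connection_unique:
  assumes "levi_civita_connection A g D" "levi_civita_connection A g D'"
  shows "D = D'"
proof (rule ext, rule ext)
  fix X Y
  show "D X Y = D' X Y"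
  proof (cases "X \<in> VF \<and> Y \<in> VF")
    case True
    then have "D X Y \<in> VF" "D' X Y \<in> VF"
      using assms by (auto simp: levi_civita_connection_def affine_connection_def)
    moreover have "G (D X Y) Z p = G (D' X Y) Z p" if "Z \<in> VF" for Z p
      using True that levi_civita_connection_koszul[OF assms(1), of X Y Z p]
        levi_civita_connection_koszul[OF assms(2), of X Y Z p] by simp
    ultimately show ?thesis by (metis metric_nondegenerate)
  next
    case False
    then have "D X Y = 0" "D' X Y = 0"
      using assms unfolding levi_civita_connection_def by blast+
    then show ?thesis by simp
  qed
qed

text \<open>The musical isomorphism at the level of vector fields: every form that is linear over the smooth
functions is the inner product with a vector field. For a general metric this follows from a
partition of unity; here it is supplied by a global frame.\<close>

definition representable :: bool where
  "representable \<longleftrightarrow> (\<forall>\<omega>.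
     (\<forall>X\<in>VF. smooth_fun A (\<omega> X)) \<longrightarrow>
     (\<forall>X\<in>VF. \<forall>Y\<in>VF. \<forall>p. \<omega> (X + Y) p = \<omega> X p + \<omega> Y p) \<longrightarrow>
     (\<forall>X\<in>VF. \<forall>u p. smooth_fun A u \<longrightarrow> \<omega> (fmult u X) p = u p * \<omega> X p) \<longrightarrow>
     (\<exists>W\<in>VF. \<forall>X\<in>VF. \<forall>p. G W X p = \<omega> X p))"

text \<open>For fixed \<open>X\<close> and \<open>Y\<close> the Koszul expression is linear over the smooth functions in \<open>Z\<close>, so it is
represented by a vector field. Each axiom of the connection is an identity of Koszul expressions,
transferred to vector fields by nondegeneracy.\<close>

lemma levi_civita_connection_exists:
  assumes representable
  shows "\<exists>D. levi_civita_connection A g D"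
proof -
  have ex: "\<exists>W. W \<in> VF \<and> (\<forall>Z\<in>VF. \<forall>p. G W Z p = koszul X Y Z p / 2)"
    if V: "X \<in> VF" "Y \<in> VF" for X Y
  proof -
    let ?\<omega> = "\<lambda>Z p. (1/2) * koszul X Y Z p"
    have "\<forall>Z\<in>VF. smooth_fun A (?\<omega> Z)"
      using smooth_mult[OF smooth_const smooth_koszul[OF V]] by blast
    moreover have "\<forall>Z\<in>VF. \<forall>W\<in>VF. \<forall>p. ?\<omega> (Z + W) p = ?\<omega> Z p + ?\<omega> W p"
      using V by (simp add: koszul_add(3))
    moreover have "\<forall>Z\<in>VF. \<forall>u p. smooth_fun A u \<longrightarrow> ?\<omega> (fmult u Z) p = u p * ?\<omega> Z p"
      using V by (simp add: koszul_fmult(3))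
    ultimately have "\<exists>W\<in>VF. \<forall>X\<in>VF. \<forall>p. G W X p = ?\<omega> X p"
      using assms[unfolded representable_def, rule_format, of ?\<omega>] by presburger
    then show ?thesis by auto
  qed
  define D where "D X Y = (if X \<in> VF \<and> Y \<in> VF
      then SOME W. W \<in> VF \<and> (\<forall>Z\<in>VF. \<forall>p. G W Z p = koszul X Y Z p / 2) else 0)" for X Y
  have D: "D X Y \<in> VF \<and> (\<forall>Z\<in>VF. \<forall>p. G (D X Y) Z p = koszul X Y Z p / 2)"
    if "X \<in> VF" "Y \<in> VF" for X Y
    using someI_ex[OF ex[OF that]] that by (simp add: D_def)
  have DV: "D X Y \<in> VF" if "X \<in> VF" "Y \<in> VF" for X Y using D[OF that] by blast
  have GD: "G (D X Y) Z p = koszul X Y Z p / 2" if "X \<in> VF" "Y \<in> VF" "Z \<in> VF" for X Y Z p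
    using D[OF that(1,2)] that(3) by blast
  have "levi_civita_connection A g D"
    unfolding levi_civita_connection_def affine_connection_def
  proof (intro conjI ballI allI impI)
    fix X Y Z assume V: "X \<in> VF" "Y \<in> VF" "Z \<in> VF"
    show "D (X + Y) Z = D X Z + D Y Z"
      by (rule metric_nondegenerate)
        (use V in \<open>simp_all add: DV vf_intros metric_rules GD koszul_add add_divide_distrib\<close>)
    show "D X (Y + Z) = D X Y + D X Z"
      by (rule metric_nondegenerate)
        (use V in \<open>simp_all add: DV vf_intros metric_rules GD koszul_add add_divide_distrib\<close>)
    show "deriv_along X (G Y Z) p = G (D X Y) Z p + G Y (D X Z) p" for p
      using V koszul_compatible[OF V, of p] by (simp add: metric_commute[of Y] DV GD)
  next
    fix X Y assume V: "X \<in> VF" "Y \<in> VF"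
    show "D X Y \<in> VF" using V by (rule DV)
    show "D X Y - D Y X = lie_bracket X Y"
    proof (rule metric_nondegenerate)
      fix Z p assume Z: "Z \<in> VF"
      show "G (D X Y - D Y X) Z p = G (lie_bracket X Y) Z p"
        using V Z koszul_torsion[OF V Z, of p] by (simp add: metric_rules DV GD)
    qed (use V in \<open>simp_all add: DV vf_intros\<close>)
    fix u assume u: "smooth_fun A u"
    show "D (fmult u X) Y = fmult u (D X Y)"
      by (rule metric_nondegenerate)
        (use V u in \<open>simp_all add: DV vf_intros metric_rules GD koszul_fmult\<close>)
    show "D X (fmult u Y) = fmult (deriv_along X u) Y + fmult u (D X Y)"
      by (rule metric_nondegenerate)
        (use V u in \<open>simp_all add: DV vf_intros smooth_intros metric_rules GD koszul_fmult add_divide_distrib\<close>)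
  next
    fix X Y assume "X \<notin> VF \<or> Y \<notin> VF"
    then show "D X Y = 0" by (auto simp: D_def)
  qed
  then show ?thesis by blast
qed

lemma levi_civita_is_connection:
  assumes representable
  shows "levi_civita_connection A g (levi_civita A g)"
proof -
  obtain D where D: "levi_civita_connection A g D"
    using levi_civita_connection_exists[OF assms] by blast
  show ?thesis
    unfolding levi_civita_def by (rule theI[of "levi_civita_connection A g", OF D]) (rule levi_civita_connection_unique[OF _ D])
qed

text \<open>The family \<open>d\<close> is the reciprocal frame of \<open>e\<close>, and \<open>\<omega>\<close> is represented by the combination of the
\<open>d i\<close> with coefficients \<open>\<omega> (e i)\<close>.\<close>

lemma representable_if_frame:
  fixes e d :: "'i \<Rightarrow> 'a vfield"
  assumes "\<And>i. i \<in> I \<Longrightarrow> e i \<in> VF" "\<And>i. i \<in> I \<Longrightarrow> d i \<in> VF"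
    and frame: "\<And>X. X \<in> VF \<Longrightarrow> X = (\<Sum>i\<in>I. fmult (G X (d i)) (e i))"
  shows representable
  unfolding representable_def
proof (intro allI impI)
  fix \<omega> :: "'a vfield \<Rightarrow> 'a \<Rightarrow> real"
  assume sm: "\<forall>X\<in>VF. smooth_fun A (\<omega> X)"
    and add: "\<forall>X\<in>VF. \<forall>Y\<in>VF. \<forall>p. \<omega> (X + Y) p = \<omega> X p + \<omega> Y p"
    and mult: "\<forall>X\<in>VF. \<forall>u p. smooth_fun A u \<longrightarrow> \<omega> (fmult u X) p = u p * \<omega> X p"
  have "\<omega> (fmult (\<lambda>q. 0) 0) p = 0" for p
    using mult[rule_format, OF vf_zero smooth_const] by simp
  then have zero: "\<omega> 0 p = 0" for p by (simp add: fmult_def zero_fun_def)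
  have sum: "\<omega> (\<Sum>i\<in>J. X i) p = (\<Sum>i\<in>J. \<omega> (X i) p)" if "\<And>i. i \<in> J \<Longrightarrow> X i \<in> VF"
    for J :: "'i set" and X p
    using that
  proof (induction J rule: infinite_finite_induct)
    case (insert i J)
    then have "\<omega> (X i + (\<Sum>i\<in>J. X i)) p = \<omega> (X i) p + (\<Sum>i\<in>J. \<omega> (X i) p)"
      using bspec[OF bspec[OF add, of "X i"], of "\<Sum>i\<in>J. X i"] vf_sum[of J X] by simp
    then show ?case by (simp only: sum.insert[OF insert.hyps])
  qed (simp_all add: zero)
  have Gsum: "G (\<Sum>i\<in>J. X i) Z p = (\<Sum>i\<in>J. G (X i) Z p)" if "\<And>i. i \<in> J \<Longrightarrow> X i \<in> VF" "Z \<in> VF"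
    for J :: "'i set" and X Z p
    using that
  proof (induction J rule: infinite_finite_induct)
    case (insert i J)
    then have "G (X i + (\<Sum>i\<in>J. X i)) Z p = G (X i) Z p + (\<Sum>i\<in>J. G (X i) Z p)"
      using metric_add_left[of "X i" "\<Sum>i\<in>J. X i" Z] vf_sum[of J X] by simp
    then show ?case by (simp only: sum.insert[OF insert.hyps])
  qed (simp_all add: metric_zero_left)
  let ?W = "\<Sum>i\<in>I. fmult (\<omega> (e i)) (d i)"
  have "?W \<in> VF" using assms sm by (intro vf_intros) auto
  moreover have "G ?W X p = \<omega> X p" if X: "X \<in> VF" for X p
  proof -
    have "G ?W X p = (\<Sum>i\<in>I. \<omega> (e i) p * G (d i) X p)"
      using assms sm X by (subst Gsum) (auto intro!: vf_intros sum.cong simp: metric_fmult_left)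
    also have "\<dots> = (\<Sum>i\<in>I. \<omega> (fmult (G X (d i)) (e i)) p)"
      using assms(1,2) sm X mult by (intro sum.cong refl) (simp add: smooth_metric metric_commute[of X])
    also have "\<dots> = \<omega> (\<Sum>i\<in>I. fmult (G X (d i)) (e i)) p"
      using assms(1,2) X by (subst sum) (auto intro!: vf_fmult smooth_metric)
    finally show ?thesis by (simp only: frame[OF X, symmetric])
  qed
  ultimately show "\<exists>W\<in>VF. \<forall>X\<in>VF. \<forall>p. G W X p = \<omega> X p" by blast
qed

end

section \<open>The Levi-Civita connection and its curvature\<close>

locale levi_civita_manifold = riemannian_manifold A g
  for A :: "('a::{t2_space,second_countable_topology}, 'e::euclidean_space) atlas" and g +
  assumes representable
begin

abbreviation "D \<equiv> levi_civita A g"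

lemma levi_civita: "levi_civita_connection A g D"
  by (rule levi_civita_is_connection) (rule levi_civita_manifold_axioms[unfolded levi_civita_manifold_def
    levi_civita_manifold_axioms_def, THEN conjunct2])

lemma vf_D [vf_intros]: "X \<in> VF \<Longrightarrow> Y \<in> VF \<Longrightarrow> D X Y \<in> VF"
  using levi_civita by (simp add: levi_civita_connection_def affine_connection_def)

lemma D_add_left: "X \<in> VF \<Longrightarrow> Y \<in> VF \<Longrightarrow> Z \<in> VF \<Longrightarrow> D (X + Y) Z = D X Z + D Y Z"
  using levi_civita by (simp add: levi_civita_connection_def affine_connection_def)

lemma D_add_right: "X \<in> VF \<Longrightarrow> Y \<in> VF \<Longrightarrow> Z \<in> VF \<Longrightarrow> D X (Y + Z) = D X Y + D X Z"
  using levi_civita by (simp add: levi_civita_connection_def affine_connection_def)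

lemma D_fmult_left: "X \<in> VF \<Longrightarrow> Y \<in> VF \<Longrightarrow> smooth_fun A u \<Longrightarrow> D (fmult u X) Y = fmult u (D X Y)"
  using levi_civita by (simp add: levi_civita_connection_def affine_connection_def)

lemma D_fmult_right:
  "X \<in> VF \<Longrightarrow> Y \<in> VF \<Longrightarrow> smooth_fun A u \<Longrightarrow>
    D X (fmult u Y) = fmult (deriv_along X u) Y + fmult u (D X Y)"
  using levi_civita by (simp add: levi_civita_connection_def affine_connection_def)

lemma D_diff_left: 
  assumes "X \<in> VF" "Y \<in> VF" "Z \<in> VF"
  shows "D (X - Y) Z = D X Z - D Y Z"
  using D_add_left[OF vf_diff[OF assms(1,2)] assms(2,3)] by simp

lemma D_diff_right:
  assumes "X \<in> VF" "Y \<in> VF" "Z \<in> VF"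
  shows "D Z (X - Y) = D Z X - D Z Y"
  using D_add_right[OF assms(3) vf_diff[OF assms(1,2)] assms(2)] by simp

lemma D_zero: "X \<in> VF \<Longrightarrow> D X 0 = 0" "X \<in> VF \<Longrightarrow> D 0 X = 0"
  using D_diff_right[of X X X] D_diff_left[of X X X] by simp_all

lemma D_torsion: 
  assumes "X \<in> VF" "Y \<in> VF"
  shows "D X Y = D Y X + lie_bracket X Y"
proof -
  have "D X Y - D Y X = lie_bracket X Y"
    using levi_civita assms by (simp add: levi_civita_connection_def)
  then show ?thesis by (simp add: algebra_simps)
qed

lemma metric_D:
  "X \<in> VF \<Longrightarrow> Y \<in> VF \<Longrightarrow> Z \<in> VF \<Longrightarrow> G (D X Y) Z p = koszul X Y Z p / 2"
  using levi_civita_connection_koszul[OF levi_civita, of X Y Z p] by simp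

lemmas D_rules = D_add_left D_add_right D_fmult_left D_fmult_right D_diff_left D_diff_right D_zero

text \<open>The two terms with the derivative of \<open>u\<close> along \<open>Y\<close> come from \<open>\<nabla>\<^sub>Y\<close> and from the bracket, and cancel.\<close>

lemma curvature_fmult:
  assumes "X \<in> VF" "Y \<in> VF" "Z \<in> VF" "smooth_fun A u"
  shows "curvature A g (fmult u X) Y Z = fmult u (curvature A g X Y Z)"
proof -
  have "curvature A g (fmult u X) Y Z = fmult u (D X (D Y Z))
     - (fmult (deriv_along Y u) (D X Z) + fmult u (D Y (D X Z)))
     - (fmult u (D (lie_bracket X Y) Z) - fmult (deriv_along Y u) (D X Z))"
    using assms unfolding curvature_def
    by (simp add: D_rules vf_intros smooth_deriv_along lie_bracket_fmult_left)
  also have "\<dots> = fmult u (curvature A g X Y Z)"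
    unfolding curvature_def by (intro ext) (simp add: fmult_apply algebra_simps)
  finally show ?thesis .
qed

lemma curvature_add:
  assumes "X \<in> VF" "W \<in> VF" "Y \<in> VF" "Z \<in> VF"
  shows "curvature A g (X + W) Y Z = curvature A g X Y Z + curvature A g W Y Z"
proof -
  have "curvature A g (X + W) Y Z = (D X (D Y Z) + D W (D Y Z)) - (D Y (D X Z) + D Y (D W Z))
     - (D (lie_bracket X Y) Z + D (lie_bracket W Y) Z)"
    using assms unfolding curvature_def
    by (simp add: D_rules vf_intros lie_bracket_add_left)
  also have "\<dots> = curvature A g X Y Z + curvature A g W Y Z"
    unfolding curvature_def by (simp add: algebra_simps)
  finally show ?thesis .
qed

end

section \<open>Contact metric structures\<close>

locale contact_metric_manifold = manifold A
  for A :: "('a::{t2_space,second_countable_topology}, 'e::euclidean_space) atlas" +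
  fixes \<eta> :: "'a form1" and \<xi> :: "'a vfield" and \<phi> :: "'a endo" and g :: "'a bilin"
  assumes contact_metric: "contact_metric_structure A \<eta> \<xi> \<phi> g"

sublocale contact_metric_manifold \<subseteq> riemannian_manifold A g
  by unfold_locales (use contact_metric in \<open>simp add: contact_metric_structure_def\<close>)

context contact_metric_manifold
begin

lemma vf_reeb [vf_intros]: "\<xi> \<in> VF"
  using contact_metric by (simp add: contact_metric_structure_def reeb_field_def)

lemma fibre_endomorphism_phi: "fibre_endomorphism A \<phi>"
  using contact_metric by (simp add: contact_metric_structure_def endomorphism_field_def)

lemma vf_phi [vf_intros]: "X \<in> VF \<Longrightarrow> app_endo \<phi> X \<in> VF"
  using contact_metric by (simp add: contact_metric_structure_def endomorphism_field_def)

lemma metric_reeb_self: "G \<xi> \<xi> = (\<lambda>p. 1)"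
  using contact_metric
  by (intro ext) (simp add: contact_metric_structure_def unit_vector_field_def pair_bilin_def)

lemma ext_deriv_phi: "X \<in> VF \<Longrightarrow> Y \<in> VF \<Longrightarrow> ext_deriv \<eta> X Y p = 2 * G X (app_endo \<phi> Y) p"
  using contact_metric by (simp add: contact_metric_structure_def associated_endo_def)

lemma ext_deriv_reeb: "X \<in> VF \<Longrightarrow> ext_deriv \<eta> \<xi> X p = 0"
  using contact_metric by (simp add: contact_metric_structure_def reeb_field_def)

lemma phi_phi:
  assumes "X \<in> VF"
  shows "app_endo \<phi> (app_endo \<phi> X) = fmult (pair_form \<eta> X) \<xi> - X"
proof
  fix p
  have "\<phi> p (\<phi> p (X p)) = - X p + \<eta> p (X p) *\<^sub>R \<xi> p"
    using contact_metric vf_tangent[OF assms] unfolding contact_metric_structure_def by blast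
  then show "app_endo \<phi> (app_endo \<phi> X) p = (fmult (pair_form \<eta> X) \<xi> - X) p"
    by (simp add: app_endo_def fmult_def pair_form_def)
qed

lemma smooth_eta [smooth_intros]: "X \<in> VF \<Longrightarrow> smooth_fun A (pair_form \<eta> X)"
  using contact_metric by (simp add: contact_metric_structure_def contact_form_def one_form_def)

lemma metric_reeb_phi: "X \<in> VF \<Longrightarrow> G \<xi> (app_endo \<phi> X) = (\<lambda>p. 0)"
  by (rule ext) (use ext_deriv_phi[OF vf_reeb, of X] ext_deriv_reeb in simp)

text \<open>Since \<open>\<phi>\<^sup>2 X = \<eta>(X) \<xi> - X\<close>, it suffices that \<open>\<xi>\<close> is orthogonal to the image of \<open>\<phi>\<close>, and
\<open>2 g(\<xi>, \<phi> Y) = d\<eta>(\<xi>, Y) = 0\<close>.\<close>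

lemma eta_eq_metric: 
  assumes "X \<in> VF"
  shows "pair_form \<eta> X = G \<xi> X"
proof
  fix p
  have "G \<xi> (app_endo \<phi> (app_endo \<phi> X)) p = 0" by (simp add: assms metric_reeb_phi vf_phi)
  then show "pair_form \<eta> X p = G \<xi> X p"
    by (simp add: phi_phi assms metric_rules vf_intros smooth_eta metric_reeb_self)
qed

lemma metric_reeb_bracket: 
  assumes "X \<in> VF" 
  shows "G \<xi> (lie_bracket \<xi> X) = deriv_along \<xi> (G \<xi> X)"
  using ext_deriv_reeb[OF assms]
  by (intro ext) (simp add: ext_deriv_def eta_eq_metric assms vf_intros metric_reeb_self deriv_along_const)

lemma metric_bracket_reeb_eq_phi:
  assumes "X \<in> VF" "Y \<in> VF"
  shows "G \<xi> (lie_bracket X Y) p = deriv_along X (G \<xi> Y) p - deriv_along Y (G \<xi> X) p - 2 * G X (app_endo \<phi> Y) p"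
  using ext_deriv_phi[OF assms, of p] by (simp add: ext_deriv_def eta_eq_metric assms vf_intros)

text \<open>This is the skew symmetry of \<open>d\<eta>\<close>.\<close>

lemma metric_phi_skew:
  assumes "X \<in> VF" "Y \<in> VF"
  shows "G X (app_endo \<phi> Y) p = - G Y (app_endo \<phi> X) p"
  using metric_bracket_reeb_eq_phi[OF assms, of p] metric_bracket_reeb_eq_phi[OF assms(2,1), of p]
  by (simp add: lie_bracket_commute[of Y X] metric_commute[of \<xi> "lie_bracket X Y"]
    metric_commute[of \<xi> "- lie_bracket X Y"] metric_minus_left assms vf_intros
    vf_diff[OF vf_zero, of "lie_bracket X Y", simplified])

lemma metric_phi_phi:
  assumes "X \<in> VF" "Y \<in> VF"
  shows "G (app_endo \<phi> X) (app_endo \<phi> Y) p = G X Y p - G \<xi> X p * G \<xi> Y p"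
  using metric_phi_skew[OF vf_phi[OF assms(1)] assms(2), of p]
  by (simp add: phi_phi assms metric_rules vf_intros smooth_intros eta_eq_metric metric_commute[of Y])

text \<open>The derivative of \<open>u\<close> along \<open>\<xi>\<close> appears in both terms of the Lie derivative and cancels.\<close>

lemma h_fmult:
  assumes "X \<in> VF" "smooth_fun A u"
  shows "h_operator \<xi> \<phi> (fmult u X) = fmult u (h_operator \<xi> \<phi> X)"
proof -
  have "lie_deriv_endo \<xi> \<phi> (fmult u X) = 
    (fmult (deriv_along \<xi> u) (app_endo \<phi> X) + fmult u (lie_bracket \<xi> (app_endo \<phi> X)))
    - (fmult (deriv_along \<xi> u) (app_endo \<phi> X) + fmult u (app_endo \<phi> (lie_bracket \<xi> X)))"
    using assms unfolding lie_deriv_endo_def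
    by (simp add: app_endo_fmult[OF fibre_endomorphism_phi] app_endo_add[OF fibre_endomorphism_phi]
      lie_bracket_fmult_right vf_intros smooth_deriv_along)
  also have "\<dots> = fmult u (lie_deriv_endo \<xi> \<phi> X)"
    unfolding lie_deriv_endo_def by (intro ext) (simp add: fmult_apply algebra_simps)
  finally show ?thesis
    unfolding h_operator_def by (intro ext) (simp add: fmult_apply scaleR_fun_def)
qed

lemma h_add:
  assumes "X \<in> VF" "Y \<in> VF"
  shows "h_operator \<xi> \<phi> (X + Y) = h_operator \<xi> \<phi> X + h_operator \<xi> \<phi> Y"
proof -
  have "lie_deriv_endo \<xi> \<phi> (X + Y) = lie_deriv_endo \<xi> \<phi> X + lie_deriv_endo \<xi> \<phi> Y"
    using assms unfolding lie_deriv_endo_def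
    by (simp add: app_endo_add[OF fibre_endomorphism_phi] lie_bracket_add_right vf_intros)
  then show ?thesis
    unfolding h_operator_def by (simp add: scaleR_add_right)
qed

lemma phi_reeb: "app_endo \<phi> \<xi> = 0"
  using contact_metric by (intro ext) (simp add: contact_metric_structure_def app_endo_def)

lemma h_reeb: "h_operator \<xi> \<phi> \<xi> = 0"
proof -
  have "app_endo \<phi> (fmult (\<lambda>p. 0) \<xi>) = fmult (\<lambda>p. 0) (app_endo \<phi> \<xi>)"
    by (rule app_endo_fmult[OF fibre_endomorphism_phi vf_reeb])
  then have "app_endo \<phi> 0 = 0" by (simp add: fmult_def zero_fun_def)
  moreover have "lie_bracket \<xi> 0 = 0"
    using lie_bracket_add_right[OF vf_reeb vf_zero vf_zero] by simp
  ultimately show ?thesis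
    unfolding h_operator_def lie_deriv_endo_def by (simp add: lie_bracket_self phi_reeb)
qed

text \<open>The image of \<open>h\<close> is orthogonal to \<open>\<xi>\<close>, because the bracket of \<open>\<xi>\<close> with a field in the kernel of
\<open>\<eta>\<close> lies again in that kernel.\<close>

lemma eta_h_eigenfield:
  assumes "X \<in> VF" "h_operator \<xi> \<phi> X = X"
  shows "G \<xi> X = (\<lambda>p. 0)"
proof
  fix p
  have X: "X = fmult (\<lambda>_. 1/2) (lie_bracket \<xi> (app_endo \<phi> X) - app_endo \<phi> (lie_bracket \<xi> X))"
    using assms(2) unfolding h_operator_def lie_deriv_endo_def scaleR_eq_fmult by simp
  have "G \<xi> (lie_bracket \<xi> (app_endo \<phi> X) - app_endo \<phi> (lie_bracket \<xi> X)) = (\<lambda>p. 0)"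
    using assms(1)
    by (simp add: metric_rules vf_intros metric_reeb_bracket metric_reeb_phi deriv_along_const)
  then have "G \<xi> (fmult (\<lambda>_. 1/2) (lie_bracket \<xi> (app_endo \<phi> X) - app_endo \<phi> (lie_bracket \<xi> X))) p = 0"
    using assms(1) by (simp add: metric_fmult_right vf_intros smooth_const)
  then show "G \<xi> X p = 0" by (simp only: X[symmetric])
qed

end

section \<open>Orthonormal frames of contact metric three-manifolds\<close>

locale contact_metric_frame = contact_metric_manifold A \<eta> \<xi> \<phi> g
  for A :: "('a::{t2_space,second_countable_topology}, real^3) atlas" and \<eta> \<xi> \<phi> g +
  fixes E :: "'a vfield"
  assumes unit_E: "unit_vector_field A g E"
    and metric_reeb_E: "G \<xi> E = (\<lambda>p. 0)"
begin

abbreviation "F \<equiv> app_endo \<phi> E"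

lemma vf_E [vf_intros]: "E \<in> VF"
  using unit_E by (simp add: unit_vector_field_def)

lemma vf_frame: "E \<in> VF" "F \<in> VF" "\<xi> \<in> VF"
  by (intro vf_intros)+

lemma phi_F: "app_endo \<phi> F = - E"
  by (intro ext) (simp add: phi_phi vf_E eta_eq_metric metric_reeb_E fmult_apply)

lemma metric_frame:
  "G E E = (\<lambda>p. 1)" "G E F = (\<lambda>p. 0)" "G E \<xi> = (\<lambda>p. 0)"
  "G F E = (\<lambda>p. 0)" "G F F = (\<lambda>p. 1)" "G F \<xi> = (\<lambda>p. 0)"
  "G \<xi> E = (\<lambda>p. 0)" "G \<xi> F = (\<lambda>p. 0)" "G \<xi> \<xi> = (\<lambda>p. 1)"
proof -
  show EE: "G E E = (\<lambda>p. 1)"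
    using unit_E by (intro ext) (simp add: unit_vector_field_def pair_bilin_def)
  show EF: "G E F = (\<lambda>p. 0)"
  proof
    show "G E F p = 0" for p using metric_phi_skew[OF vf_E vf_E, of p] by simp
  qed
  show "G F E = (\<lambda>p. 0)" using EF metric_commute[of F E] by (simp add: vf_frame)
  show "G \<xi> E = (\<lambda>p. 0)" by (rule metric_reeb_E)
  then show "G E \<xi> = (\<lambda>p. 0)" using metric_commute[of E \<xi>] by (simp add: vf_frame)
  show "G \<xi> F = (\<lambda>p. 0)" by (rule metric_reeb_phi[OF vf_E])
  then show "G F \<xi> = (\<lambda>p. 0)" using metric_commute[of F \<xi>] by (simp add: vf_frame)
  show "G F F = (\<lambda>p. 1)"
    by (intro ext) (simp add: metric_phi_phi vf_E EE metric_reeb_E)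
  show "G \<xi> \<xi> = (\<lambda>p. 1)" by (rule metric_reeb_self)
qed

definition frame :: "nat \<Rightarrow> 'a vfield" where
  "frame i = (if i = 0 then E else if i = 1 then F else \<xi>)"

lemma tangent_expansion:
  assumes "v \<in> tangent_space A p"
  shows "v = g p v (E p) *\<^sub>R E p + g p v (F p) *\<^sub>R F p + g p v (\<xi> p) *\<^sub>R \<xi> p"
proof -
  have "v = (\<Sum>i\<in>{0,1,2}. g p v (frame i p) *\<^sub>R frame i p)"
  proof (rule orthonormal_frame_expansion[OF _ _ _ _ assms])
    show "frame i \<in> VF" for i by (simp add: frame_def vf_frame)
    show "G (frame i) (frame j) p = (if i = j then 1 else 0)" if "i \<in> {0,1,2}" "j \<in> {0,1,2}" for i j
      using that by (auto simp: frame_def metric_frame)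
  qed simp_all
  also have "\<dots> = g p v (E p) *\<^sub>R E p + g p v (F p) *\<^sub>R F p + g p v (\<xi> p) *\<^sub>R \<xi> p"
    by (simp add: frame_def add.assoc)
  finally show ?thesis .
qed

lemma field_expansion:
  assumes "X \<in> VF"
  shows "X = fmult (G X E) E + fmult (G X F) F + fmult (G X \<xi>) \<xi>"
proof
  fix p
  have "(fmult (G X E) E + fmult (G X F) F + fmult (G X \<xi>) \<xi>) p
      = g p (X p) (E p) *\<^sub>R E p + g p (X p) (F p) *\<^sub>R F p + g p (X p) (\<xi> p) *\<^sub>R \<xi> p"
    by (simp add: fmult_def pair_bilin_def)
  also have "\<dots> = X p" by (rule tangent_expansion[OF vf_tangent[OF assms], symmetric])
  finally show "X p = (fmult (G X E) E + fmult (G X F) F + fmult (G X \<xi>) \<xi>) p" by (rule sym)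
qed

lemma field_eqI:
  assumes "X \<in> VF" "Y \<in> VF" "G X E = G Y E" "G X F = G Y F" "G X \<xi> = G Y \<xi>"
  shows "X = Y"
proof (rule trans[OF field_expansion[OF assms(1)]])
  show "fmult (G X E) E + fmult (G X F) F + fmult (G X \<xi>) \<xi> = Y"
    unfolding assms(3-5) by (rule field_expansion[OF assms(2), symmetric])
qed

lemma representable: representable
proof (rule representable_if_frame[of "{0,1,2}" frame frame])
  show "frame i \<in> VF" for i by (simp add: frame_def vf_frame)
  show "frame i \<in> VF" for i by (simp add: frame_def vf_frame)
  fix X assume "X \<in> VF"
  have "(\<Sum>i\<in>{0,1,2}. fmult (G X (frame i)) (frame i))
      = fmult (G X E) E + fmult (G X F) F + fmult (G X \<xi>) \<xi>"
    by (simp add: frame_def add.assoc)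
  also have "\<dots> = X" using field_expansion[OF \<open>X \<in> VF\<close>] by (rule sym)
  finally show "X = (\<Sum>i\<in>{0,1,2}. fmult (G X (frame i)) (frame i))" by (rule sym)
qed

lemma field_coordinates:
  assumes "X \<in> VF"
  obtains u v w where "smooth_fun A u" "smooth_fun A v" "smooth_fun A w"
    "X = fmult u E + fmult v F + fmult w \<xi>"
  by (rule that[OF smooth_metric[OF assms vf_frame(1)] smooth_metric[OF assms vf_frame(2)]
        smooth_metric[OF assms vf_frame(3)] field_expansion[OF assms]])

lemma tangent_extends:
  assumes "v \<in> tangent_space A p"
  obtains X where "X \<in> VF" "X p = v"
proof (rule that)
  let ?X = "fmult (\<lambda>_. g p v (E p)) E + fmult (\<lambda>_. g p v (F p)) F + fmult (\<lambda>_. g p v (\<xi> p)) \<xi>"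
  show "?X \<in> VF" by (intro vf_intros smooth_const)
  have "?X p = g p v (E p) *\<^sub>R E p + g p v (F p) *\<^sub>R F p + g p v (\<xi> p) *\<^sub>R \<xi> p"
    by (simp add: fmult_def)
  also have "\<dots> = v" by (rule tangent_expansion[OF assms, symmetric])
  finally show "?X p = v" .
qed

text \<open>This holds for any symmetric bilinear form, the coefficients being those of the given metric; it is
what makes the deformed metric computable on arbitrary tangent vectors.\<close>

lemma bilinear_expansion:
  assumes B: "fibre_symmetric_bilinear A B" and v: "v \<in> tangent_space A p" "w \<in> tangent_space A p"
  shows "B p v w = g p v (E p) * B p (E p) w + g p v (F p) * B p (F p) w + g p v (\<xi> p) * B p (\<xi> p) w"
proof -
  have add: "B p (s + t) w = B p s w + B p t w" if "s \<in> tangent_space A p" "t \<in> tangent_space A p" for s t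
    using B v(2) that by (simp add: fibre_symmetric_bilinear_def)
  have scale: "B p (k *\<^sub>R s) w = k * B p s w" if "s \<in> tangent_space A p" for s k
    using B v(2) that by (simp add: fibre_symmetric_bilinear_def)
  have T: "k *\<^sub>R X p \<in> tangent_space A p" if "X \<in> VF" for X k
    by (rule subspace_scale[OF subspace_tangent_space vf_tangent[OF that]])
  have "B p v w = B p (g p v (E p) *\<^sub>R E p + g p v (F p) *\<^sub>R F p + g p v (\<xi> p) *\<^sub>R \<xi> p) w"
    by (rule arg_cong[where f="\<lambda>u. B p u w"]) (rule tangent_expansion[OF v(1)])
  also have "\<dots> = B p (g p v (E p) *\<^sub>R E p) w + B p (g p v (F p) *\<^sub>R F p) w + B p (g p v (\<xi> p) *\<^sub>R \<xi> p) w"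
    unfolding add[OF subspace_add[OF subspace_tangent_space T[OF vf_frame(1)] T[OF vf_frame(2)]] T[OF vf_frame(3)]]
      add[OF T[OF vf_frame(1)] T[OF vf_frame(2)]] ..
  finally show ?thesis
    unfolding scale[OF vf_tangent[OF vf_frame(1)]] scale[OF vf_tangent[OF vf_frame(2)]]
      scale[OF vf_tangent[OF vf_frame(3)]] .
qed

end

sublocale contact_metric_frame \<subseteq> levi_civita_manifold A g
  by unfold_locales (rule representable)

section \<open>Brackets of the frame in the flat case\<close>

locale flat_contact_frame = contact_metric_frame A \<eta> \<xi> \<phi> g E
  for A :: "('a::{t2_space,second_countable_topology}, real^3) atlas" and \<eta> \<xi> \<phi> g E +
  assumes flat: "flat_metric A g"
    and h_E: "h_operator \<xi> \<phi> E = E"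
begin

lemma zero_if_eq_minus: "c = - s \<Longrightarrow> c = 0 \<Longrightarrow> s = (0 :: 'b::group_add)"
  by simp

lemma flat_zero: "X \<in> VF \<Longrightarrow> Y \<in> VF \<Longrightarrow> Z \<in> VF \<Longrightarrow> curvature A g X Y Z = 0"
  using flat by (simp add: flat_metric_def)

definition "\<alpha> = G (lie_bracket \<xi> E) E"
definition "\<beta> = G (lie_bracket \<xi> E) F"
definition "\<gamma> = G (lie_bracket E F) E"
definition "\<delta> = G (lie_bracket E F) F"

lemma smooth_coeffs: "smooth_fun A \<alpha>" "smooth_fun A \<beta>" "smooth_fun A \<gamma>" "smooth_fun A \<delta>"
  unfolding \<alpha>_def \<beta>_def \<gamma>_def \<delta>_def by (intro smooth_metric vf_intros)+

lemma metric_bracket_reeb_E: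
  "G (lie_bracket \<xi> E) E = \<alpha>" "G (lie_bracket \<xi> E) F = \<beta>" "G (lie_bracket \<xi> E) \<xi> = (\<lambda>p. 0)"
  by (simp_all add: \<alpha>_def \<beta>_def metric_commute[of "lie_bracket \<xi> E" \<xi>] vf_intros metric_reeb_bracket metric_frame
      deriv_along_const)

lemma bracket_reeb_E: "lie_bracket \<xi> E = fmult \<alpha> E + fmult \<beta> F"
  using field_expansion[of "lie_bracket \<xi> E", symmetric]
  by (simp add: vf_intros metric_bracket_reeb_E fmult_zero)

text \<open>The eigenvalue equation \<open>h E = E\<close> reads \<open>[\<xi>, F] = 2 E + \<phi> [\<xi>, E]\<close>.\<close>

lemma bracket_reeb_F: "lie_bracket \<xi> F = fmult (\<lambda>p. 2 - \<beta> p) E + fmult \<alpha> F"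
proof -
  have "app_endo \<phi> (lie_bracket \<xi> E) = fmult \<alpha> F + fmult \<beta> (- E)"
    by (simp add: bracket_reeb_E app_endo_add[OF fibre_endomorphism_phi]
        app_endo_fmult[OF fibre_endomorphism_phi] vf_intros smooth_coeffs phi_F)
  moreover have "lie_bracket \<xi> F = fmult (\<lambda>_. 2) E + app_endo \<phi> (lie_bracket \<xi> E)"
  proof (intro ext)
    fix p f
    show "lie_bracket \<xi> F p f = (fmult (\<lambda>_. 2) E + app_endo \<phi> (lie_bracket \<xi> E)) p f"
      using fun_cong[OF fun_cong[OF h_E], of p f]
      by (simp add: h_operator_def lie_deriv_endo_def scaleR_fun_def fmult_apply)
  qed
  ultimately show ?thesis by (intro ext) (simp add: fmult_apply algebra_simps)
qed

lemma metric_bracket_reeb_F: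
  "G (lie_bracket \<xi> F) E = (\<lambda>p. 2 - \<beta> p)" "G (lie_bracket \<xi> F) F = \<alpha>"
  "G (lie_bracket \<xi> F) \<xi> = (\<lambda>p. 0)"
  by (simp_all add: bracket_reeb_F metric_rules metric_frame vf_intros smooth_coeffs smooth_diff smooth_const)

text \<open>The component along \<open>\<xi>\<close> is \<open>\<eta>([E, F]) = - d\<eta>(E, F) = - 2 g(E, \<phi> F) = 2\<close>.\<close>

lemma metric_bracket_E_F:
  "G (lie_bracket E F) E = \<gamma>" "G (lie_bracket E F) F = \<delta>" "G (lie_bracket E F) \<xi> = (\<lambda>p. 2)"
proof -
  have "G \<xi> (lie_bracket E F) = (\<lambda>p. 2)"
  proof
    fix p
    have "G E (app_endo \<phi> F) p = - 1"
      using metric_phi_skew[of E F p] by (simp add: vf_frame metric_frame)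
    then show "G \<xi> (lie_bracket E F) p = 2"
      by (simp add: metric_bracket_reeb_eq_phi vf_frame metric_frame deriv_along_const)
  qed
  then show "G (lie_bracket E F) \<xi> = (\<lambda>p. 2)"
    by (simp add: metric_commute[of "lie_bracket E F" \<xi>] vf_intros)
qed (simp_all add: \<gamma>_def \<delta>_def)

lemma bracket_E_F: "lie_bracket E F = fmult \<gamma> E + fmult \<delta> F + fmult (\<lambda>p. 2) \<xi>"
  using field_expansion[of "lie_bracket E F", symmetric] by (simp add: vf_intros metric_bracket_E_F)

lemmas koszul_table = metric_D vf_intros koszul_def metric_frame deriv_along_const lie_bracket_self
  metric_zero_left lie_bracket_commute[of E \<xi>] lie_bracket_commute[of F \<xi>] lie_bracket_commute[of F E]
  metric_minus_left metric_bracket_reeb_E metric_bracket_reeb_F metric_bracket_E_F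

lemma metric_D_reeb:
  "G (D E \<xi>) E p = - \<alpha> p" "G (D E \<xi>) F p = - 2" "G (D E \<xi>) \<xi> p = 0"
  "G (D F \<xi>) E p = 0" "G (D F \<xi>) F p = - \<alpha> p" "G (D F \<xi>) \<xi> p = 0"
  "G (D \<xi> \<xi>) E p = 0" "G (D \<xi> \<xi>) F p = 0" "G (D \<xi> \<xi>) \<xi> p = 0"
  "G (D \<xi> E) E p = 0" "G (D \<xi> E) F p = \<beta> p - 2"
  "G (D \<xi> F) E p = 2 - \<beta> p" "G (D \<xi> F) F p = 0"
  "G (D F F) E p = \<delta> p" "G (D F F) F p = 0"
  by (simp_all add: koszul_table)

lemma D_reeb:
  "D E \<xi> = fmult (\<lambda>p. - \<alpha> p) E + fmult (\<lambda>p. - 2) F"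
  "D F \<xi> = fmult (\<lambda>p. - \<alpha> p) F"
  "D \<xi> \<xi> = 0"
  by (rule field_eqI; (intro ext)?; simp add: metric_D_reeb metric_rules metric_frame metric_zero_left
      vf_intros smooth_intros smooth_coeffs)+

text \<open>The component of \<open>R(E, \<xi>) \<xi>\<close> along \<open>F\<close> is \<open>- 4 \<alpha>\<close>. Once \<open>\<alpha>\<close> vanishes identically, so does its
derivative, and the component along \<open>E\<close> becomes \<open>4 - 2 \<beta>\<close>.\<close>

lemma \<alpha>_zero_\<beta>_two: "\<alpha> p = 0" "\<beta> p = 2"
proof -
  have neg: "lie_bracket E \<xi> = fmult (\<lambda>p. - \<alpha> p) E + fmult (\<lambda>p. - \<beta> p) F"
    by (intro ext) (simp add: lie_bracket_commute[of E \<xi>] bracket_reeb_E fmult_apply)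
  \<comment> \<open>\<open>?S\<close> is \<open>- R(E, \<xi>) \<xi>\<close>; the first summand only contributes along \<open>E\<close>.\<close>
  let ?S = "fmult (deriv_along \<xi> (\<lambda>p. - \<alpha> p)) E + fmult (\<lambda>p. - \<alpha> p) (D \<xi> E)
      + fmult (\<lambda>p. - 2) (D \<xi> F)
      + (fmult (\<lambda>p. - \<alpha> p) (D E \<xi>) + fmult (\<lambda>p. - \<beta> p) (D F \<xi>))"
  have "curvature A g E \<xi> \<xi> = - ?S"
    unfolding curvature_def neg D_reeb(3)
    by (subst D_reeb(1))
      (simp add: D_rules vf_intros smooth_intros smooth_coeffs deriv_along_const fmult_zero)
  then have S: "?S = 0" by (rule zero_if_eq_minus[OF _ flat_zero[OF vf_frame(1,3,3)]])
  have "G ?S F p = 4 * \<alpha> p" for p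
    by (simp add: metric_rules vf_intros smooth_intros smooth_coeffs metric_frame metric_D_reeb
        algebra_simps)
  then have \<alpha>: "\<alpha> p = 0" for p
    unfolding S by (simp add: metric_zero_left vf_frame)
  then show "\<alpha> p = 0" .
  have "\<alpha> = (\<lambda>p. 0)" using \<alpha> by (rule ext)
  then have "G ?S E p = 2 * \<beta> p - 4" for p
    by (simp add: metric_rules vf_intros smooth_intros smooth_coeffs metric_frame metric_D_reeb
        deriv_along_const algebra_simps)
  then show "\<beta> p = 2"
    unfolding S by (simp add: metric_zero_left vf_frame)
qed

text \<open>Now \<open>\<nabla>\<^sub>F \<xi> = 0\<close> and \<open>\<nabla>\<^sub>E \<xi> = - 2 F\<close>, so \<open>R(E, F) \<xi>\<close> is \<open>2 \<nabla>\<^sub>F F + 2 \<gamma> F\<close>, and \<open>\<nabla>\<^sub>F F = \<delta> E\<close>.\<close>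

lemma bracket_coeffs_zero: "\<gamma> p = 0" "\<delta> p = 0"
proof -
  have DE: "D E \<xi> = fmult (\<lambda>p. - 2) F" and DF: "D F \<xi> = 0"
    unfolding D_reeb \<alpha>_zero_\<beta>_two by (intro ext; simp add: fmult_apply)+
  let ?S = "fmult (\<lambda>p. - 2) (D F F) + fmult \<gamma> (fmult (\<lambda>p. - 2) F)"
  have "curvature A g E F \<xi> = - ?S"
    unfolding curvature_def bracket_E_F
    by (simp add: D_rules vf_intros smooth_intros smooth_coeffs deriv_along_const DE DF D_reeb(3)
        fmult_zero fmult_field_zero)
  then have S: "?S = 0" by (rule zero_if_eq_minus[OF _ flat_zero[OF vf_frame(1,2,3)]])
  have "G ?S F p = - 2 * \<gamma> p" "G ?S E p = - 2 * \<delta> p"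
    by (simp_all add: metric_rules vf_intros smooth_intros smooth_coeffs metric_frame metric_D_reeb)
  then show "\<gamma> p = 0" "\<delta> p = 0"
    unfolding S by (simp_all add: metric_zero_left vf_frame)
qed

lemma brackets:
  "lie_bracket \<xi> E = fmult (\<lambda>p. 2) F" "lie_bracket \<xi> F = 0" "lie_bracket E F = fmult (\<lambda>p. 2) \<xi>"
  unfolding bracket_reeb_E bracket_reeb_F bracket_E_F
  by (intro ext; simp add: fmult_apply \<alpha>_zero_\<beta>_two bracket_coeffs_zero)+

end

section \<open>The deformed contact metric structure\<close>

locale deformed_flat_contact = flat_contact_frame A \<eta> \<xi> \<phi> g E
  for A :: "('a::{t2_space,second_countable_topology}, real^3) atlas" and \<eta> \<xi> \<phi> g E +
  fixes f :: "'a \<Rightarrow> real" and gf :: "'a bilin" and \<phi>f :: "'a endo"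
  assumes smooth_f: "smooth_fun A f"
    and reeb_f: "deriv_along \<xi> f = (\<lambda>p. 0)"
    and bilinear_gf: "fibre_symmetric_bilinear A gf"
    and gf_E_E: "gf p (E p) (E p) = 1 + f p + (1/2) * (f p)^2"
    and gf_F_F: "gf p (F p) (F p) = 1 - f p + (1/2) * (f p)^2"
    and gf_E_F: "gf p (E p) (F p) = (1/2) * (f p)^2"
    and gf_reeb_E: "gf p (\<xi> p) (E p) = 0"
    and gf_reeb_F: "gf p (\<xi> p) (F p) = 0"
    and gf_reeb_reeb: "gf p (\<xi> p) (\<xi> p) = 1"
    and endo_phif: "fibre_endomorphism A \<phi>f"
    and associated_phif: "associated_endo A \<eta> gf \<phi>f"
begin

text \<open>The entries of the deformed metric on the frame: \<open>a\<close> on \<open>(E, E)\<close>, \<open>b\<close> on \<open>(F, F)\<close> and \<open>c\<close> on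
\<open>(E, F)\<close>. In terms of \<open>s = 1 - b\<close>, the functions \<open>\<kappa>\<close> and \<open>\<mu>\<close> are \<open>s (2 - s)\<close> and \<open>2 s\<close>. The square is
written as a product, to which the Leibniz rule applies directly.\<close>

definition a :: "'a \<Rightarrow> real" where "a p = 1 + f p + (1/2) * (f p * f p)"
definition b :: "'a \<Rightarrow> real" where "b p = 1 - f p + (1/2) * (f p * f p)"
definition c :: "'a \<Rightarrow> real" where "c p = (1/2) * (f p * f p)"
definition s :: "'a \<Rightarrow> real" where "s p = f p - (1/2) * (f p * f p)"

lemma smooth_abcs: "smooth_fun A a" "smooth_fun A b" "smooth_fun A c" "smooth_fun A s"
  unfolding a_def[abs_def] b_def[abs_def] c_def[abs_def] s_def[abs_def]
  by (intro smooth_add smooth_diff smooth_mult smooth_const smooth_f)+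

lemma determinant_one: "a p * b p = 1 + c p * c p"
  by (simp add: a_def b_def c_def algebra_simps)

lemma b_eq: "b p = 1 - s p"
  by (simp add: b_def s_def)

lemma a_pos: "a p > 0"
proof -
  have "a p = ((1 + f p) * (1 + f p) + 1) / 2" by (simp add: a_def algebra_simps)
  moreover have "(1 + f p) * (1 + f p) + 1 > 0" by (rule add_nonneg_pos) simp_all
  ultimately show ?thesis by simp
qed

lemma deriv_abcs:
  "deriv_along \<xi> a = (\<lambda>p. 0)" "deriv_along \<xi> b = (\<lambda>p. 0)" "deriv_along \<xi> c = (\<lambda>p. 0)"
  "deriv_along \<xi> s = (\<lambda>p. 0)"
  unfolding a_def[abs_def] b_def[abs_def] c_def[abs_def] s_def[abs_def]
  by (simp_all add: deriv_along_rules smooth_intros smooth_f vf_intros reeb_f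
      del: times_divide_eq_left)

abbreviation "G' \<equiv> pair_bilin gf"

lemma gf_commute: "v \<in> tangent_space A p \<Longrightarrow> w \<in> tangent_space A p \<Longrightarrow> gf p v w = gf p w v"
  using bilinear_gf by (simp add: fibre_symmetric_bilinear_def)

lemma gf_frame:
  "G' E E = a" "G' E F = c" "G' E \<xi> = (\<lambda>p. 0)"
  "G' F E = c" "G' F F = b" "G' F \<xi> = (\<lambda>p. 0)"
  "G' \<xi> E = (\<lambda>p. 0)" "G' \<xi> F = (\<lambda>p. 0)" "G' \<xi> \<xi> = (\<lambda>p. 1)"
proof -
  show "G' E E = a" "G' E F = c" "G' F F = b" "G' \<xi> E = (\<lambda>p. 0)" "G' \<xi> F = (\<lambda>p. 0)" "G' \<xi> \<xi> = (\<lambda>p. 1)"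
    by (intro ext; simp add: pair_bilin_def gf_E_E gf_E_F gf_F_F gf_reeb_E gf_reeb_F gf_reeb_reeb
        a_def b_def c_def power2_eq_square)+
  then show "G' F E = c" "G' E \<xi> = (\<lambda>p. 0)" "G' F \<xi> = (\<lambda>p. 0)"
    by (simp_all add: fun_eq_iff pair_bilin_def gf_commute[OF vf_tangent[OF vf_frame(2)] vf_tangent[OF vf_frame(1)]]
      gf_commute[OF vf_tangent[OF vf_frame(1)] vf_tangent[OF vf_frame(3)]]
      gf_commute[OF vf_tangent[OF vf_frame(2)] vf_tangent[OF vf_frame(3)]])
qed

lemma gf_expansion:
  assumes v: "v \<in> tangent_space A p" "w \<in> tangent_space A p"
  shows "gf p v w = a p * (g p v (E p) * g p w (E p))
      + c p * (g p v (E p) * g p w (F p) + g p v (F p) * g p w (E p))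
      + b p * (g p v (F p) * g p w (F p)) + g p v (\<xi> p) * g p w (\<xi> p)"
proof -
  have sw: "gf p (X p) w = g p w (E p) * gf p (E p) (X p) + g p w (F p) * gf p (F p) (X p)
      + g p w (\<xi> p) * gf p (\<xi> p) (X p)" if "X \<in> VF" for X
    using bilinear_expansion[OF bilinear_gf v(2) vf_tangent[OF that]]
      gf_commute[OF vf_tangent[OF that] v(2)] by simp
  have fr: "gf p (E p) (E p) = a p" "gf p (E p) (F p) = c p" "gf p (E p) (\<xi> p) = 0"
    "gf p (F p) (E p) = c p" "gf p (F p) (F p) = b p" "gf p (F p) (\<xi> p) = 0"
    "gf p (\<xi> p) (E p) = 0" "gf p (\<xi> p) (F p) = 0" "gf p (\<xi> p) (\<xi> p) = 1"
    using gf_frame by (simp_all add: pair_bilin_def fun_eq_iff)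
  show ?thesis
    unfolding bilinear_expansion[OF bilinear_gf v] sw[OF vf_frame(1)] sw[OF vf_frame(2)] sw[OF vf_frame(3)] fr
    by (simp add: algebra_simps)
qed

text \<open>For positivity, complete the square: \<open>a\<close> times the quadratic form with matrix \<open>(a, c; c, b)\<close> at
\<open>(x, y)\<close> is \<open>(a x + c y)^2 + y^2\<close>, since the determinant is \<open>1\<close>.\<close>

lemma metric_gf: "riemannian_metric A gf"
  unfolding riemannian_metric_def
proof (intro conjI ballI allI impI bilinear_gf)
  fix X Y assume V: "X \<in> VF" "Y \<in> VF"
  have "G' X Y = (\<lambda>p. a p * (G X E p * G Y E p) + c p * (G X E p * G Y F p + G X F p * G Y E p)
      + b p * (G X F p * G Y F p) + G X \<xi> p * G Y \<xi> p)"
    using gf_expansion[OF vf_tangent[OF V(1)] vf_tangent[OF V(2)]]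
    by (intro ext) (simp add: pair_bilin_def)
  then show "smooth_fun A (G' X Y)"
    using V by (simp add: smooth_add smooth_mult smooth_metric smooth_abcs vf_frame)
next
  fix p v assume v: "v \<in> tangent_space A p" "v \<noteq> 0"
  let ?x = "g p v (E p)" and ?y = "g p v (F p)" and ?z = "g p v (\<xi> p)"
  have nz: "?x \<noteq> 0 \<or> ?y \<noteq> 0 \<or> ?z \<noteq> 0"
  proof (rule ccontr)
    assume "\<not> ?thesis"
    then have "?x = 0" "?y = 0" "?z = 0" by auto
    then have "?x *\<^sub>R E p + ?y *\<^sub>R F p + ?z *\<^sub>R \<xi> p = 0"
      by (simp only: scaleR_zero_left add_0_left)
    with v(2) tangent_expansion[OF v(1)] show False by metis
  qed
  have "a p * gf p v v = (a p * ?x + c p * ?y) * (a p * ?x + c p * ?y)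
      + (a p * b p - c p * c p) * (?y * ?y) + a p * (?z * ?z)"
    unfolding gf_expansion[OF v(1) v(1)] by (simp add: algebra_simps)
  also have "\<dots> = (a p * ?x + c p * ?y)\<^sup>2 + ?y\<^sup>2 + a p * ?z\<^sup>2"
    by (simp add: determinant_one power2_eq_square)
  also have "\<dots> > 0"
  proof (cases "?y = 0 \<and> ?z = 0")
    case True
    then have "?x \<noteq> 0" using nz by blast
    then show ?thesis using True a_pos[of p] by simp
  next
    case False
    have "0 < ?y\<^sup>2 + a p * ?z\<^sup>2"
    proof (cases "?y = 0")
      case True
      with False show ?thesis using a_pos[of p] by simp
    next
      case y: False
      show ?thesis using y a_pos[of p] by (intro add_pos_nonneg) simp_all
    qed
    then show ?thesis using zero_le_power2[of "a p * ?x + c p * ?y"] by linarith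
  qed
  finally show "gf p v v > 0" using a_pos[of p] by (simp add: zero_less_mult_iff)
qed

end

sublocale deformed_flat_contact \<subseteq> deformed: riemannian_manifold A gf
  by unfold_locales (rule metric_gf)

context deformed_flat_contact
begin

lemmas deformed_rules = deformed.metric_rules gf_frame vf_intros smooth_intros smooth_abcs

lemma field_eqI_deformed:
  assumes V: "X \<in> VF" "Y \<in> VF"
    and "G' X E = G' Y E" "G' X F = G' Y F" "G' X \<xi> = G' Y \<xi>"
  shows "X = Y"
proof (rule deformed.metric_nondegenerate[OF V])
  fix Z p assume "Z \<in> VF"
  then obtain u v w where Z: "smooth_fun A u" "smooth_fun A v" "smooth_fun A w"
      "Z = fmult u E + fmult v F + fmult w \<xi>"
    by (rule field_coordinates)
  show "G' X Z p = G' Y Z p"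
    unfolding Z(4) using V Z(1-3) assms(3-5) by (simp add: deformed.metric_rules vf_intros)
qed

text \<open>Since the determinant is \<open>1\<close>, the inverse matrix has the entries \<open>b\<close>, \<open>- c\<close>, \<open>a\<close>, and it gives the
reciprocal frame without division.\<close>

lemma representable_deformed: "deformed.representable"
proof (rule deformed.representable_if_frame[of "{0,1,2}" frame
      "\<lambda>i. if i = 0 then fmult b E + fmult (\<lambda>p. - c p) F
            else if i = 1 then fmult (\<lambda>p. - c p) E + fmult a F else \<xi>"])
  show "frame i \<in> VF" for i by (simp add: frame_def vf_frame)
  show "(if i = 0 then fmult b E + fmult (\<lambda>p. - c p) F
            else if i = 1 then fmult (\<lambda>p. - c p) E + fmult a F else \<xi>) \<in> VF" for i :: nat
    by (simp add: vf_intros smooth_minus smooth_abcs)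
  fix X assume "X \<in> VF"
  then obtain u v w where X: "smooth_fun A u" "smooth_fun A v" "smooth_fun A w"
      "X = fmult u E + fmult v F + fmult w \<xi>"
    by (rule field_coordinates)
  have coords: "u p = b p * (u p * a p + v p * c p) - c p * (u p * c p + v p * b p)"
    "v p = a p * (u p * c p + v p * b p) - c p * (u p * a p + v p * c p)" for p
    using determinant_one[of p] by algebra+
  have "G' X (fmult b E + fmult (\<lambda>p. - c p) F) = u"
    "G' X (fmult (\<lambda>p. - c p) E + fmult a F) = v" "G' X \<xi> = w"
    unfolding X(4) using X(1-3) coords
    by (intro ext; simp add: deformed_rules)+
  then show "X = (\<Sum>i\<in>{0,1,2}. fmult (G' X (if i = 0 then fmult b E + fmult (\<lambda>p. - c p) F
            else if i = 1 then fmult (\<lambda>p. - c p) E + fmult a F else \<xi>)) (frame i))"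
    using X(4) by (simp add: frame_def add.assoc)
qed

text \<open>Both \<open>\<phi>\<close> with \<open>g\<close> and \<open>\<phi>f\<close> with the deformed metric represent \<open>d\<eta>\<close>, so \<open>\<phi>f X\<close> is determined by
\<open>\<phi> X\<close>. The argument is pointwise: smoothness of \<open>\<phi>f X\<close> is a consequence, since \<open>W\<close> is smooth.\<close>

lemma phif_eqI:
  assumes V: "X \<in> VF" "W \<in> VF"
    and "\<And>p. G' W E p = G E (app_endo \<phi> X) p" "\<And>p. G' W F p = G F (app_endo \<phi> X) p"
      "\<And>p. G' W \<xi> p = G \<xi> (app_endo \<phi> X) p"
  shows "app_endo \<phi>f X = W"
proof
  fix p
  let ?v = "\<phi>f p (X p)"
  have v: "?v \<in> tangent_space A p"
    using endo_phif vf_tangent[OF V(1)] by (simp add: fibre_endomorphism_def)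
  then obtain Y where Y: "Y \<in> VF" "Y p = ?v" by (rule tangent_extends)
  have YZ: "G' Y Z p = G Z (app_endo \<phi> X) p" if "Z \<in> VF" for Z
  proof -
    have "2 * G' Z (app_endo \<phi>f X) p = ext_deriv \<eta> Z X p"
      using associated_phif V(1) that by (simp add: associated_endo_def)
    also have "\<dots> = 2 * G Z (app_endo \<phi> X) p" by (rule ext_deriv_phi[OF that V(1)])
    finally have "G' Z Y p = G Z (app_endo \<phi> X) p"
      using Y(2) by (simp add: pair_bilin_def app_endo_def)
    then show ?thesis by (simp add: deformed.metric_commute[OF Y(1) that])
  qed
  have DV: "Y - W \<in> VF" by (rule vf_diff[OF Y(1) V(2)])
  have 0: "G' (Y - W) Z p = 0" if "Z \<in> {E, F, \<xi>}" for Z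
    using that YZ[of Z] assms(3-5)[of p] by (auto simp: deformed.metric_diff_left Y(1) V(2) vf_frame)
  from DV obtain k l m where D: "smooth_fun A k" "smooth_fun A l" "smooth_fun A m"
      "Y - W = fmult k E + fmult l F + fmult m \<xi>"
    by (rule field_coordinates)
  have "G' (Y - W) (fmult k E + fmult l F + fmult m \<xi>) p = 0"
    using DV D(1-3) 0 by (simp add: deformed.metric_rules vf_intros)
  then have "gf p ((Y - W) p) ((Y - W) p) = 0"
    unfolding D(4)[symmetric] by (simp only: pair_bilin_def)
  then have "(Y - W) p = 0"
    using metric_gf vf_tangent[OF DV, of p] unfolding riemannian_metric_def by (metis less_irrefl)
  then show "app_endo \<phi>f X p = W p" using Y(2) by (simp add: app_endo_def)
qed

lemma phif_frame:
  "app_endo \<phi>f E = fmult (\<lambda>p. - c p) E + fmult a F"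
  "app_endo \<phi>f F = fmult (\<lambda>p. - b p) E + fmult c F"
  "app_endo \<phi>f \<xi> = 0"
proof -
  have mF: "app_endo \<phi> F = fmult (\<lambda>_. - 1) E"
    by (intro ext) (simp add: phi_F fmult_apply)
  show "app_endo \<phi>f E = fmult (\<lambda>p. - c p) E + fmult a F"
    by (rule phif_eqI) (simp_all add: deformed_rules metric_frame, simp add: determinant_one algebra_simps)
  show "app_endo \<phi>f F = fmult (\<lambda>p. - b p) E + fmult c F"
    unfolding mF by (rule phif_eqI; (unfold mF)?; simp add: deformed_rules metric_rules metric_frame;
        simp add: determinant_one algebra_simps)
  show "app_endo \<phi>f \<xi> = 0"
    by (rule phif_eqI) (simp_all add: phi_reeb vf_intros deformed.metric_zero_left metric_commute[OF _ vf_zero]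
        metric_zero_left)
qed

lemma phif_coordinates:
  assumes "smooth_fun A u" "smooth_fun A v" "smooth_fun A w"
  shows "app_endo \<phi>f (fmult u E + fmult v F + fmult w \<xi>)
    = fmult (\<lambda>p. - (u p * c p + v p * b p)) E + fmult (\<lambda>p. u p * a p + v p * c p) F + fmult (\<lambda>p. 0) \<xi>"
proof -
  have "app_endo \<phi>f (fmult u E + fmult v F + fmult w \<xi>)
      = fmult u (app_endo \<phi>f E) + fmult v (app_endo \<phi>f F) + fmult w (app_endo \<phi>f \<xi>)"
    using assms by (simp add: app_endo_add[OF endo_phif] app_endo_fmult[OF endo_phif] vf_intros)
  then show ?thesis
    unfolding phif_frame by (intro ext) (simp add: fmult_apply algebra_simps)
qed

text \<open>On the contact planes the matrix of \<open>\<phi>f\<close> has trace \<open>0\<close> and determinant \<open>a b - c^2 = 1\<close>, hence square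
\<open>- 1\<close>. Tangent vectors are extended to vector fields so that the frame computation applies.\<close>

lemma contact_metric_deformed: "contact_metric_structure A \<eta> \<xi> \<phi>f gf"
  unfolding contact_metric_structure_def
proof (intro conjI allI ballI)
  show "contact_form A \<eta>" "reeb_field A \<eta> \<xi>"
    using contact_metric by (simp_all add: contact_metric_structure_def)
  show "endomorphism_field A \<phi>f"
    unfolding endomorphism_field_def
  proof (intro conjI ballI endo_phif)
    fix X assume "X \<in> VF"
    then obtain u v w where X: "smooth_fun A u" "smooth_fun A v" "smooth_fun A w"
        "X = fmult u E + fmult v F + fmult w \<xi>"
      by (rule field_coordinates)
    show "app_endo \<phi>f X \<in> VF"
      unfolding X(4) phif_coordinates[OF X(1-3)] using X(1-3)
      by (simp add: vf_intros smooth_intros smooth_abcs)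
  qed
  show "riemannian_metric A gf" by (rule metric_gf)
  show "unit_vector_field A gf \<xi>"
    by (simp add: unit_vector_field_def vf_intros gf_reeb_reeb)
  show "\<phi>f p (\<xi> p) = 0" for p
    using fun_cong[OF phif_frame(3), of p] by (simp add: app_endo_def)
  show "associated_endo A \<eta> gf \<phi>f" by (rule associated_phif)
  fix p and v :: "'a tvec" assume "v \<in> tangent_space A p"
  then obtain X where X0: "X \<in> VF" "X p = v" by (rule tangent_extends)
  then obtain k l m where X: "smooth_fun A k" "smooth_fun A l" "smooth_fun A m"
      "X = fmult k E + fmult l F + fmult m \<xi>"
    using field_coordinates by blast
  have "pair_form \<eta> X = m"
    unfolding eta_eq_metric[OF X0(1)] unfolding X(4) using X(1-3)
    by (simp add: metric_rules metric_frame vf_intros)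
  moreover have "app_endo \<phi>f (app_endo \<phi>f X) = fmult m \<xi> - X"
  proof -
    have coords: "- ((- (k p * c p + l p * b p)) * c p + (k p * a p + l p * c p) * b p) = - k p"
      "(- (k p * c p + l p * b p)) * a p + (k p * a p + l p * c p) * c p = - l p" for p
      using determinant_one[of p] by algebra+
    show ?thesis
      unfolding X(4) phif_coordinates[OF X(1-3)]
      using X(1-3) coords
      by (subst phif_coordinates) (simp_all add: smooth_intros smooth_abcs, intro ext, simp add: fmult_apply)
  qed
  ultimately have "app_endo \<phi>f (app_endo \<phi>f X) p = (fmult (pair_form \<eta> X) \<xi> - X) p" by simp
  then show "\<phi>f p (\<phi>f p v) = - v + \<eta> p v *\<^sub>R \<xi> p"
    using X0(2) by (simp add: app_endo_def fmult_def pair_form_def)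
qed

end

sublocale deformed_flat_contact \<subseteq> deformed: contact_metric_manifold A \<eta> \<xi> \<phi>f gf
  by unfold_locales (rule contact_metric_deformed)

sublocale deformed_flat_contact \<subseteq> deformed: levi_civita_manifold A gf
  by unfold_locales (rule representable_deformed)

context deformed_flat_contact
begin

abbreviation "D' \<equiv> levi_civita A gf"

section \<open>The curvature of the deformed metric\<close>

lemma brackets_reversed:
  "lie_bracket E \<xi> = fmult (\<lambda>p. - 2) F" "lie_bracket F \<xi> = 0" "lie_bracket F E = fmult (\<lambda>p. - 2) \<xi>"
  unfolding lie_bracket_commute[of E \<xi>] lie_bracket_commute[of F \<xi>] lie_bracket_commute[of F E] brackets
  by (intro ext; simp add: fmult_apply)+

text \<open>In the Koszul expression with second argument \<open>\<xi>\<close>, every term with a derivative either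
differentiates along \<open>\<xi>\<close> or differentiates an inner product with \<open>\<xi>\<close>; all of them vanish.\<close>

lemma metric_D'_reeb:
  "G' (D' E \<xi>) E p = - 2 * c p" "G' (D' E \<xi>) F p = - (b p + 1)" "G' (D' E \<xi>) \<xi> p = 0"
  "G' (D' F \<xi>) E p = 1 - b p" "G' (D' F \<xi>) F p = 0" "G' (D' F \<xi>) \<xi> p = 0"
  "G' (D' \<xi> \<xi>) E p = 0" "G' (D' \<xi> \<xi>) F p = 0" "G' (D' \<xi> \<xi>) \<xi> p = 0"
  by (simp_all add: deformed.metric_D deformed.koszul_def vf_intros gf_frame deriv_abcs deriv_along_const
      lie_bracket_self deformed.metric_zero_left brackets brackets_reversed deformed.metric_fmult_left)

lemma D'_reeb:
  "D' E \<xi> = fmult (\<lambda>p. c p * s p) E + fmult (\<lambda>p. - (a p * s p + 2)) F"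
  "D' F \<xi> = fmult (\<lambda>p. b p * s p) E + fmult (\<lambda>p. - (c p * s p)) F"
  "D' \<xi> \<xi> = 0"
proof -
  have E_E: "c p * s p * a p + - (a p * s p + 2) * c p = - 2 * c p" for p
    by (simp add: algebra_simps)
  have E_F: "c p * s p * c p + - (a p * s p + 2) * b p = - (b p + 1)" for p
  proof -
    have "c p * s p * c p + - (a p * s p + 2) * b p = - s p - 2 * b p"
      using determinant_one[of p] by algebra
    then show ?thesis by (simp add: b_eq)
  qed
  have F_E: "b p * s p * a p - c p * s p * c p = 1 - b p" for p
  proof -
    have "b p * s p * a p - c p * s p * c p = s p" using determinant_one[of p] by algebra
    then show ?thesis by (simp add: b_eq)
  qed
  show "D' E \<xi> = fmult (\<lambda>p. c p * s p) E + fmult (\<lambda>p. - (a p * s p + 2)) F"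
    "D' F \<xi> = fmult (\<lambda>p. b p * s p) E + fmult (\<lambda>p. - (c p * s p)) F"
    "D' \<xi> \<xi> = 0"
    using E_E E_F F_E
    by (rule_tac [!] field_eqI_deformed)
      (simp_all add: metric_D'_reeb fun_eq_iff deformed_rules deformed.vf_D deformed.metric_zero_left)
qed

lemma D'_reeb_frame:
  "D' \<xi> E = fmult (\<lambda>p. c p * s p) E + fmult (\<lambda>p. - (a p * s p)) F"
  "D' \<xi> F = fmult (\<lambda>p. b p * s p) E + fmult (\<lambda>p. - (c p * s p)) F"
proof -
  have "D' \<xi> E = D' E \<xi> + fmult (\<lambda>p. 2) F"
    using deformed.D_torsion[OF vf_frame(3,1)] by (simp only: brackets)
  then show "D' \<xi> E = fmult (\<lambda>p. c p * s p) E + fmult (\<lambda>p. - (a p * s p)) F"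
    unfolding D'_reeb by (intro ext) (simp add: fmult_apply algebra_simps)
  have "D' \<xi> F = D' F \<xi>"
    using deformed.D_torsion[OF vf_frame(3,2)] by (simp only: brackets add_0_right)
  then show "D' \<xi> F = fmult (\<lambda>p. b p * s p) E + fmult (\<lambda>p. - (c p * s p)) F"
    by (simp only: D'_reeb)
qed

lemma D'_reeb_coordinates:
  assumes "smooth_fun A u" "smooth_fun A v" "deriv_along \<xi> u = (\<lambda>p. 0)" "deriv_along \<xi> v = (\<lambda>p. 0)"
  shows "D' \<xi> (fmult u E + fmult v F)
    = fmult (\<lambda>p. (u p * c p + v p * b p) * s p) E + fmult (\<lambda>p. - (u p * a p + v p * c p) * s p) F"
proof -
  have "D' \<xi> (fmult u E + fmult v F) = fmult u (D' \<xi> E) + fmult v (D' \<xi> F)"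
    using assms by (simp add: deformed.D_rules vf_intros fmult_zero)
  then show ?thesis
    unfolding D'_reeb_frame by (intro ext) (simp add: fmult_apply algebra_simps)
qed

text \<open>The coefficients of \<open>\<nabla>\<^sub>E \<xi>\<close> are constant along \<open>\<xi>\<close>, so the curvature is purely algebraic in them.\<close>

lemma curvature_E:
  "curvature A gf E \<xi> \<xi> = fmult (\<lambda>p. s p * s p + 4 * b p * s p) E + fmult (\<lambda>p. - (4 * c p * s p)) F"
proof -
  have "D' \<xi> (D' E \<xi>) = fmult (\<lambda>p. (c p * s p * c p + - (a p * s p + 2) * b p) * s p) E
      + fmult (\<lambda>p. - (c p * s p * a p + - (a p * s p + 2) * c p) * s p) F"
    unfolding D'_reeb(1)
    by (rule D'_reeb_coordinates)
      (simp_all add: smooth_intros smooth_abcs deriv_along_rules deriv_abcs vf_intros)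
  moreover have "D' E (D' \<xi> \<xi>) = 0" by (simp add: D'_reeb(3) deformed.D_zero vf_frame)
  moreover have "D' (lie_bracket E \<xi>) \<xi> = fmult (\<lambda>p. - 2) (D' F \<xi>)"
    by (simp add: brackets_reversed deformed.D_fmult_left vf_frame smooth_const)
  ultimately have "curvature A gf E \<xi> \<xi> = 0 - (fmult (\<lambda>p. (c p * s p * c p + - (a p * s p + 2) * b p) * s p) E
      + fmult (\<lambda>p. - (c p * s p * a p + - (a p * s p + 2) * c p) * s p) F)
      - fmult (\<lambda>p. - 2) (fmult (\<lambda>p. b p * s p) E + fmult (\<lambda>p. - (c p * s p)) F)"
    by (simp only: curvature_def D'_reeb(2))
  also have "\<dots> = fmult (\<lambda>p. s p * s p + 4 * b p * s p) E + fmult (\<lambda>p. - (4 * c p * s p)) F"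
  proof (intro ext)
    fix p k
    have "- (c p * s p * c p + - (a p * s p + 2) * b p) * s p + 2 * (b p * s p) = s p * s p + 4 * b p * s p"
      using determinant_one[of p] by algebra
    then have "- (c p * s p * c p + - (a p * s p + 2) * b p) * s p * E p k + 2 * (b p * s p) * E p k
        = (s p * s p + 4 * b p * s p) * E p k"
      by (simp only: distrib_right[symmetric])
    then show "(0 - (fmult (\<lambda>p. (c p * s p * c p + - (a p * s p + 2) * b p) * s p) E
      + fmult (\<lambda>p. - (c p * s p * a p + - (a p * s p + 2) * c p) * s p) F)
      - fmult (\<lambda>p. - 2) (fmult (\<lambda>p. b p * s p) E + fmult (\<lambda>p. - (c p * s p)) F)) p k
      = (fmult (\<lambda>p. s p * s p + 4 * b p * s p) E + fmult (\<lambda>p. - (4 * c p * s p)) F) p k"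
      by (simp add: fmult_apply algebra_simps)
  qed
  finally show ?thesis .
qed

lemma curvature_F: "curvature A gf F \<xi> \<xi> = fmult (\<lambda>p. s p * s p) F"
proof -
  have "D' \<xi> (D' F \<xi>) = fmult (\<lambda>p. (b p * s p * c p + - (c p * s p) * b p) * s p) E
      + fmult (\<lambda>p. - (b p * s p * a p + - (c p * s p) * c p) * s p) F"
    unfolding D'_reeb(2)
    by (rule D'_reeb_coordinates)
      (simp_all add: smooth_intros smooth_abcs deriv_along_rules deriv_abcs vf_intros)
  then have "curvature A gf F \<xi> \<xi> = 0 - (fmult (\<lambda>p. (b p * s p * c p + - (c p * s p) * b p) * s p) E
      + fmult (\<lambda>p. - (b p * s p * a p + - (c p * s p) * c p) * s p) F) - 0"
    by (simp only: curvature_def D'_reeb(3) brackets_reversed deformed.D_zero vf_frame)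
  also have "\<dots> = fmult (\<lambda>p. s p * s p) F"
  proof (intro ext)
    fix p k
    have "(b p * s p * a p + - (c p * s p) * c p) * s p = s p * s p"
      using determinant_one[of p] by algebra
    then have "(b p * s p * a p + - (c p * s p) * c p) * s p * F p k = s p * s p * F p k" by simp
    then show "(0 - (fmult (\<lambda>p. (b p * s p * c p + - (c p * s p) * b p) * s p) E
      + fmult (\<lambda>p. - (b p * s p * a p + - (c p * s p) * c p) * s p) F) - 0) p k = fmult (\<lambda>p. s p * s p) F p k"
      by (simp add: fmult_apply algebra_simps)
  qed
  finally show ?thesis .
qed

lemma curvature_reeb: "curvature A gf \<xi> \<xi> \<xi> = 0"
  by (simp add: curvature_def D'_reeb(3) deformed.D_zero vf_frame lie_bracket_self)

text \<open>As the coefficients of \<open>\<phi>f\<close> are constant along \<open>\<xi>\<close> and \<open>[\<xi>, F] = 0\<close>, only \<open>[\<xi>, E] = 2 F\<close>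
contributes.\<close>

lemma h_frame:
  "h_operator \<xi> \<phi>f E = fmult b E + fmult (\<lambda>p. - 2 * c p) F"
  "h_operator \<xi> \<phi>f F = fmult (\<lambda>p. - b p) F"
proof -
  have br: "lie_bracket \<xi> (fmult u E + fmult v F) = fmult (\<lambda>p. 2 * u p) F"
    if "smooth_fun A u" "smooth_fun A v" "deriv_along \<xi> u = (\<lambda>p. 0)" "deriv_along \<xi> v = (\<lambda>p. 0)" for u v
  proof -
    have "lie_bracket \<xi> (fmult u E + fmult v F) = fmult u (fmult (\<lambda>p. 2) F)"
      using that by (simp add: lie_bracket_add_right lie_bracket_fmult_right vf_intros brackets
          fmult_zero fmult_field_zero)
    then show ?thesis by (intro ext) (simp add: fmult_apply)
  qed
  have "lie_bracket \<xi> (app_endo \<phi>f E) = fmult (\<lambda>p. 2 * - c p) F"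
    "lie_bracket \<xi> (app_endo \<phi>f F) = fmult (\<lambda>p. 2 * - b p) F"
    unfolding phif_frame
    by (rule br; simp add: smooth_intros smooth_abcs deriv_along_rules deriv_abcs vf_intros)+
  moreover have "app_endo \<phi>f (lie_bracket \<xi> E) = fmult (\<lambda>p. 2) (fmult (\<lambda>p. - b p) E + fmult c F)"
    by (simp add: brackets app_endo_fmult[OF endo_phif] vf_frame phif_frame)
  moreover have "app_endo \<phi>f (lie_bracket \<xi> F) = 0"
    using app_endo_fmult[OF endo_phif vf_zero, of "\<lambda>_. 0"] by (simp add: brackets fmult_zero)
  ultimately show "h_operator \<xi> \<phi>f E = fmult b E + fmult (\<lambda>p. - 2 * c p) F"
    "h_operator \<xi> \<phi>f F = fmult (\<lambda>p. - b p) F"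
    unfolding h_operator_def lie_deriv_endo_def
    by (simp_all only:) (intro ext; simp add: fmult_apply scaleR_fun_def algebra_simps)+
qed

text \<open>Both sides of the Jacobi condition are linear over the smooth functions in \<open>X\<close>, so it can be
checked on the frame. On \<open>\<xi>\<close> both sides vanish, on \<open>F\<close> the condition is \<open>s^2 = s (2 - s) - 2 s b\<close>,
and on \<open>E\<close> it is \<open>s^2 + 4 b s = s (2 - s) + 2 s b\<close> together with \<open>- 4 c s = 2 s (- 2 c)\<close>; all
hold because \<open>b = 1 - s\<close>.\<close>

lemma generalized_jacobi:
  "generalized_jacobi A \<eta> \<xi> \<phi>f gf (\<lambda>p. s p * (2 - s p)) (\<lambda>p. 2 * s p)"
  unfolding generalized_jacobi_def
proof (intro conjI ballI contact_metric_deformed)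
  show "smooth_fun A (\<lambda>p. s p * (2 - s p))" "smooth_fun A (\<lambda>p. 2 * s p)"
    by (simp_all add: smooth_mult smooth_diff smooth_const smooth_abcs)
  fix X assume V: "X \<in> VF"
  then obtain u v w where X: "smooth_fun A u" "smooth_fun A v" "smooth_fun A w"
      "X = fmult u E + fmult v F + fmult w \<xi>"
    by (rule field_coordinates)
  have \<eta>X: "pair_form \<eta> X = w"
    unfolding eta_eq_metric[OF V] unfolding X(4) using X(1-3)
    by (simp add: metric_rules metric_frame vf_intros)
  have "curvature A gf X \<xi> \<xi> = fmult u (curvature A gf E \<xi> \<xi>) + fmult v (curvature A gf F \<xi> \<xi>)
      + fmult w (curvature A gf \<xi> \<xi> \<xi>)"
    unfolding X(4) using X(1-3) by (simp add: deformed.curvature_add deformed.curvature_fmult vf_intros)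
  moreover have "h_operator \<xi> \<phi>f X = fmult u (h_operator \<xi> \<phi>f E) + fmult v (h_operator \<xi> \<phi>f F)
      + fmult w (h_operator \<xi> \<phi>f \<xi>)"
    unfolding X(4) using X(1-3) by (simp add: deformed.h_add deformed.h_fmult vf_intros)
  ultimately show "curvature A gf X \<xi> \<xi> = fmult (\<lambda>p. s p * (2 - s p)) (X - fmult (pair_form \<eta> X) \<xi>)
      + fmult (\<lambda>p. 2 * s p) (h_operator \<xi> \<phi>f X)"
    unfolding \<eta>X h_frame deformed.h_reeb curvature_E curvature_F curvature_reeb unfolding X(4)
    by (intro ext) (simp add: fmult_apply b_eq algebra_simps)
qed

end

theorem proposition6:
  fixes A :: "('a::{t2_space,second_countable_topology}, real^3) atlas"
    and \<eta> :: "'a form1" and \<xi> E :: "'a vfield" and \<phi> \<phi>f :: "'a endo" and g gf :: "'a bilin"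
    and f :: "'a \<Rightarrow> real"
  assumes "closed_manifold A"
    and "contact_metric_structure A \<eta> \<xi> \<phi> g"
    and "flat_metric A g"
    and "unit_vector_field A g E"
    and "h_operator \<xi> \<phi> E = E"
    and "smooth_fun A f"
    and "\<And>p. differential f p (\<xi> p) = 0"
    and "\<And>p. differential f p (\<phi> p (E p)) = 0"
    and "fibre_symmetric_bilinear A gf"
    and "\<And>p. gf p (E p) (E p) = 1 + f p + (1/2) * (f p)^2"
    and "\<And>p. gf p (\<phi> p (E p)) (\<phi> p (E p)) = 1 - f p + (1/2) * (f p)^2"
    and "\<And>p. gf p (E p) (\<phi> p (E p)) = (1/2) * (f p)^2"
    and "\<And>p. gf p (\<xi> p) (E p) = 0"
    and "\<And>p. gf p (\<xi> p) (\<phi> p (E p)) = 0"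
    and "\<And>p. gf p (\<xi> p) (\<xi> p) = 1"
    and "fibre_endomorphism A \<phi>f"
    and "associated_endo A \<eta> gf \<phi>f"
  shows "generalized_jacobi A \<eta> \<xi> \<phi>f gf
           (\<lambda>p. (f p - (1/2) * (f p)^2) * (2 - f p + (1/2) * (f p)^2))
           (\<lambda>p. 2 * (f p - (1/2) * (f p)^2))"
proof -
  interpret contact_metric_manifold A \<eta> \<xi> \<phi> g
    by unfold_locales (use assms(1,2) in \<open>simp_all add: closed_manifold_def\<close>)
  have E: "E \<in> VF" using assms(4) by (simp add: unit_vector_field_def)
  interpret deformed_flat_contact A \<eta> \<xi> \<phi> g E f gf \<phi>f
  proof unfold_locales
    show "G \<xi> E = (\<lambda>p. 0)" by (rule eta_h_eigenfield[OF E assms(5)])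
  qed (use assms(3-) in \<open>simp_all add: app_endo_def deriv_along_def differential_def\<close>)
  show ?thesis
    using generalized_jacobi by (simp add: s_def power2_eq_square algebra_simps)
qed

end
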